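(* If $E$ is an infinite set of integers, then there is a subset $S\subseteq E-E$ such that $S$ is chromatically recurrent and not density recurrent.
   Context: For $A\subseteq\mathbb Z$, $A-A:=\{a_1-a_2: a_1,a_2\in A\}$. The upper asymptotic density of $A\subseteq \mathbb Z$ is $\bar d(A):=\limsup_{n\to\infty}\frac{|A\cap\{1,\dots,n\}|}{n}$. A set $S\subseteq\mathbb Z$ is density recurrent (a set of density recurrence) if $(A-A)\cap S\neq\varnothing$ for every $A\subseteq\mathbb Z$ with $\bar d(A)>0$. A set $S\subseteq\mathbb Z$ is chromatically recurrent (a set of chromatic recurrence) if for every partition $\{A_1,\dots,A_r\}$ of $\mathbb Z$ into finitely many sets, there is a cell $A_j$ with $(A_j-A_j)\cap S\neq\varnothing$. *)

theory Defs
  imports Complex_Main "HOL-Library.Disjoint_Sets" "HOL-Library.Extended_Real" "HOL-Library.Liminf_Limsup"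
begin

(* The minus sign on sets is set-theoretic difference, hence a separate name for A - A. *)
definition difference_set :: "int set \<Rightarrow> int set" where
  "difference_set A = {a1 - a2 | a1 a2. a1 \<in> A \<and> a2 \<in> A}"

(* The quotient at n = 0 is 0 / 0 = 0 and does not affect the limsup. *)
definition upper_density :: "int set \<Rightarrow> ereal" where
  "upper_density A = limsup (\<lambda>n. ereal (real (card (A \<inter> {1..int n})) / real n))"

definition density_recurrent :: "int set \<Rightarrow> bool" where
  "density_recurrent S \<longleftrightarrow>
     (\<forall>A. upper_density A > 0 \<longrightarrow> difference_set A \<inter> S \<noteq> {})"

definition chromatically_recurrent :: "int set \<Rightarrow> bool" where
  "chromatically_recurrent S \<longleftrightarrow>
     (\<forall>P. finite P \<and> partition_on UNIV P \<longrightarrow> (\<exists>A\<in>P. difference_set A \<inter> S \<noteq> {}))"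

end

(*
Idea. Colour the subsets of {1..d} with k colours. By Tucker's lemma for the cross-polytope, two
subsets of the same colour differ in more than d - k points (this is the topological input of Kriz's
example, in the form of the chromatic number of a Kneser-type graph). Attach to the subsets X elements
e(X) of E that grow fast; the differences e(X) - e(Y) of such pairs then meet every k-colouring of the
integers. Since e grows fast, there are rotations a(1), ..., a(d) of a circle such that e(X) - e(Y) acts
on almost all coordinates nearly as a half turn. The integers for which a majority of the coordinates
lies in the first half circle form a set of density almost 1/2 without these differences. Given a
periodic set A that avoids finitely many earlier differences and whose translate A + c is disjoint from
A, gluing A and A + c along the two majorities gives a periodic set that avoids the old and the new
differences and has almost the density of A. Iterating with k = 1, 2, ... and splicing long blocks
of the successive sets gives the result.
*)

theory Submission
  imports Defs "HOL-Library.FuncSet"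
begin

text \<open>One set of differences must defeat every number of colours, yet a single set of positive
  density must avoid all of it, so the densities must not decay from stage to stage. Fewer than
  \<open>k\<close> coordinates escape the half turn and could vote arbitrarily; a majority therefore
  has to win by a margin tied to \<open>k\<close>. This costs little because \<open>d\<close> is
  free: the share of subsets within a fixed margin of \<open>d / 2\<close> tends to 0. The disjoint
  translate needed for the gluing comes at no cost, since any difference \<open>c\<close> avoided by
  \<open>A\<close> makes \<open>A\<close> and \<open>A + c\<close> disjoint, and each stage hands
  such a \<open>c\<close> to the next. New differences are multiples of the period of
  \<open>A\<close>, so that only the phases react to them; old differences are so small beside the
  new elements of \<open>E\<close> that the phases hardly react to them. The start point of the
  rotations is found by averaging, which replaces any equidistribution argument. Upper density only
  asks for good windows, hence the final set is spliced from blocks instead of being a limit of the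
  periodic sets.\<close>

section \<open>Tucker's lemma for the cross-polytope\<close>

text \<open>In the order of increasing absolute value, the signs are \<open>+, -, +, \<dots>\<close>\<close>

definition alternating :: "int set \<Rightarrow> bool" where
  "alternating L \<longleftrightarrow> (\<forall>x\<in>L. sgn x = (- 1) ^ card {y \<in> L. \<bar>y\<bar> < \<bar>x\<bar>})"

lemma alternating_insert_Max:
  assumes "finite L" "\<And>y. y \<in> L \<Longrightarrow> \<bar>y\<bar> < \<bar>x\<bar>"
  shows "alternating (insert x L) \<longleftrightarrow> alternating L \<and> sgn x = (- 1) ^ card L"
proof -
  have "{y \<in> insert x L. \<bar>y\<bar> < \<bar>x\<bar>} = L" using assms by auto
  moreover have "{y \<in> insert x L. \<bar>y\<bar> < \<bar>z\<bar>} = {y \<in> L. \<bar>y\<bar> < \<bar>z\<bar>}" if "z \<in> L" for z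
    using assms(2)[OF that] by auto
  ultimately show ?thesis unfolding alternating_def by auto
qed

text \<open>The local count in Fan's argument: for nonempty \<open>L\<close>, an alternating
  \<open>L\<close> can only lose its last element, an alternating negative of \<open>L\<close> only
  its first. The induction takes off the element \<open>x\<close> of largest absolute value; every
  deletion below it reverses the sign that \<open>x\<close> must have.\<close>

lemma even_card_alternating_facets:
  assumes "finite L" "inj_on abs L" "0 \<notin> L"
  shows "even (card {x \<in> L. alternating (L - {x})}) \<longleftrightarrow> (alternating L \<longleftrightarrow> alternating (uminus ` L))"
  using assms
proof (induction L rule: finite_ranking_induct[where f = abs])
  case empty
  then show ?case by (simp add: alternating_def)
next
  case (insert x L)
  show ?case
  proof (cases "x \<in> L")
    case True
    then show ?thesis using insert by (simp add: insert_absorb)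
  next
    case False
    have less: "\<bar>y\<bar> < \<bar>x\<bar>" if "y \<in> L" for y
    proof -
      have "\<bar>y\<bar> \<noteq> \<bar>x\<bar>" using inj_onD[OF insert.prems(1), of y x] that False by blast
      then show ?thesis using insert.hyps(2)[OF that] by simp
    qed
    have IH: "even (card {y \<in> L. alternating (L - {y})}) \<longleftrightarrow> (alternating L \<longleftrightarrow> alternating (uminus ` L))"
      using insert by auto
    have a: "alternating (insert x L) \<longleftrightarrow> alternating L \<and> sgn x = (- 1) ^ card L"
      using alternating_insert_Max[OF \<open>finite L\<close>] less by blast
    have c: "card (uminus ` L) = card L" by (simp add: card_image)
    have "\<bar>y\<bar> < \<bar>- x\<bar>" if "y \<in> uminus ` L" for y using that less by auto
    then have b: "alternating (uminus ` insert x L) \<longleftrightarrow> alternating (uminus ` L) \<and> - sgn x = (- 1) ^ card L"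
      using alternating_insert_Max[of "uminus ` L" "- x"] \<open>finite L\<close> c by (simp add: sgn_minus)
    have d: "alternating (insert x L - {y}) \<longleftrightarrow> alternating (L - {y}) \<and> - sgn x = (- 1) ^ card L"
      if "y \<in> L" for y
    proof -
      have "alternating (insert x (L - {y})) \<longleftrightarrow> alternating (L - {y}) \<and> sgn x = (- 1) ^ card (L - {y})"
        using alternating_insert_Max[of "L - {y}" x] \<open>finite L\<close> less by auto
      moreover have "insert x L - {y} = insert x (L - {y})" using that False by auto
      moreover have "card L = Suc (card (L - {y}))" using that \<open>finite L\<close> by (rule_tac card.remove) auto
      ultimately show ?thesis by (auto simp: minus_equation_iff)
    qed
    have sx: "sgn x = (- 1) ^ card L \<or> - sgn x = (- 1) ^ card L"
      using insert.prems(2) by (cases "even (card L)") (auto simp: sgn_if)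
    have sx': "\<not> (sgn x = (- 1) ^ card L \<and> - sgn x = (- 1) ^ card L)"
      using insert.prems(2) by (auto simp: sgn_if)
    have "{y \<in> insert x L. alternating (insert x L - {y})} =
        {y. y = x \<and> alternating L} \<union> {y \<in> L. alternating (L - {y}) \<and> - sgn x = (- 1) ^ card L}"
      using False d by auto
    moreover have "card ({y. y = x \<and> alternating L} \<union> {y \<in> L. alternating (L - {y}) \<and> - sgn x = (- 1) ^ card L})
      = (if alternating L then 1 else 0) +
        (if - sgn x = (- 1) ^ card L then card {y \<in> L. alternating (L - {y})} else 0)"
      using False \<open>finite L\<close> by (subst card_Un_disjoint) auto
    ultimately have count: "card {y \<in> insert x L. alternating (insert x L - {y})} =
      (if alternating L then 1 else 0) +
        (if - sgn x = (- 1) ^ card L then card {y \<in> L. alternating (L - {y})} else 0)" by simp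
    \<comment> \<open>\<open>P\<close> and \<open>Q\<close> stand for the alternation of
      \<open>L\<close> and of its negative, \<open>s\<close> and \<open>t\<close> for the two
      possible signs of \<open>x\<close>, and \<open>m\<close> for the count in the induction
      hypothesis.\<close>
    have key: "even ((if P then 1 else 0) + (if t then m else 0)) \<longleftrightarrow> (P \<and> s \<longleftrightarrow> Q \<and> t)"
      if "s \<noteq> t" "even m \<longleftrightarrow> (P \<longleftrightarrow> Q)" for P Q s t and m :: nat
      using that by (cases P; cases s) auto
    show ?thesis unfolding count a b by (rule key[OF _ IH]) (use sx sx' in blast)
  qed
qed

text \<open>The image set forgets multiplicities; injectivity is demanded so that a face with a
  repeated label does not count.\<close>

definition alternating_on :: "('a \<Rightarrow> int) \<Rightarrow> 'a set \<Rightarrow> bool" where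
  "alternating_on g J \<longleftrightarrow> inj_on g J \<and> alternating (g ` J)"

text \<open>If two vertices share a label, only the deletion of one of these two can leave distinct
  labels, and both deletions leave the same labels, so the count is 0 or 2. Otherwise
  \<open>nc\<close> makes the absolute values distinct and the count for sets applies.\<close>

lemma even_card_alternating_on_facets:
  assumes "finite J" and nz: "\<And>x. x \<in> J \<Longrightarrow> g x \<noteq> 0"
    and nc: "\<And>x y. x \<in> J \<Longrightarrow> y \<in> J \<Longrightarrow> g x \<noteq> - g y"
  shows "even (card {x \<in> J. alternating_on g (J - {x})}) \<longleftrightarrow>
    (alternating_on g J \<longleftrightarrow> alternating_on (\<lambda>x. - g x) J)"
proof (cases "inj_on g J")
  case True
  have "g ` {x \<in> J. alternating_on g (J - {x})} = {y \<in> g ` J. alternating (g ` J - {y})}"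
  proof -
    have "alternating_on g (J - {x}) \<longleftrightarrow> alternating (g ` J - {g x})" if "x \<in> J" for x
    proof -
      have "g ` (J - {x}) = g ` J - {g x}" using True that by (auto simp: inj_on_def)
      moreover have "inj_on g (J - {x})" using True by (rule inj_on_subset) auto
      ultimately show ?thesis by (simp add: alternating_on_def)
    qed
    then show ?thesis by auto
  qed
  moreover have "inj_on g {x \<in> J. alternating_on g (J - {x})}"
    using True by (rule inj_on_subset) auto
  ultimately have 1: "card {x \<in> J. alternating_on g (J - {x})} = card {y \<in> g ` J. alternating (g ` J - {y})}"
    using card_image by fastforce
  have "inj_on abs (g ` J)" using nc by (force simp: inj_on_def abs_eq_iff)
  then have 2: "even (card {y \<in> g ` J. alternating (g ` J - {y})}) \<longleftrightarrow>
      (alternating (g ` J) \<longleftrightarrow> alternating (uminus ` g ` J))"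
    using assms by (intro even_card_alternating_facets) (auto dest: nz)
  have "inj_on (\<lambda>x. - g x) J" using True by (auto simp: inj_on_def)
  then show ?thesis using 1 2 True by (simp add: alternating_on_def image_image)
next
  case False
  then obtain a b where ab: "a \<in> J" "b \<in> J" "a \<noteq> b" "g a = g b" by (auto simp: inj_on_def)
  have "\<not> inj_on (\<lambda>x. - g x) J" using False by (auto simp: inj_on_def)
  moreover have "even (card {x \<in> J. alternating_on g (J - {x})})"
  proof -
    have im: "g ` (J - {a}) = g ` (J - {b})"
    proof -
      have "g x \<in> g ` (J - {a})" "g x \<in> g ` (J - {b})" if "x \<in> J" for x
        using ab that by (metis DiffI imageI singletonD)+
      then show ?thesis by blast
    qed
    have "inj_on g (J - {a}) \<longleftrightarrow> inj_on g (J - {b})"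
    proof -
      have "card (J - {a}) = card (J - {b})" using ab \<open>finite J\<close> by simp
      then show ?thesis using im \<open>finite J\<close> by (metis eq_card_imp_inj_on card_image finite_Diff)
    qed
    then have eq: "alternating_on g (J - {a}) \<longleftrightarrow> alternating_on g (J - {b})"
      using im by (simp add: alternating_on_def)
    have "\<not> inj_on g (J - {x})" if "x \<notin> {a, b}" for x using ab that by (auto simp: inj_on_def)
    then have "\<not> alternating_on g (J - {x})" if "x \<notin> {a, b}" for x
      using that unfolding alternating_on_def by blast
    then have sub: "{x \<in> J. alternating_on g (J - {x})} = {x \<in> {a, b}. alternating_on g (J - {x})}"
      using ab(1,2) by blast
    show ?thesis
    proof (cases "alternating_on g (J - {a})")
      case True
      then have "{x \<in> {a, b}. alternating_on g (J - {x})} = {a, b}" using eq by blast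
      then show ?thesis using ab(3) sub by simp
    next
      case False
      then have "{x \<in> {a, b}. alternating_on g (J - {x})} = {}" using eq by blast
      then show ?thesis using sub by (metis card.empty even_zero)
    qed
  qed
  ultimately show ?thesis using False by (simp add: alternating_on_def)
qed

section \<open>Facets of the subdivision and their neighbours\<close>

lemma even_card_involution:
  assumes "finite X" "\<And>x. x \<in> X \<Longrightarrow> f x \<in> X" "\<And>x. x \<in> X \<Longrightarrow> f (f x) = x" "\<And>x. x \<in> X \<Longrightarrow> f x \<noteq> x"
  shows "even (card X)"
  using assms
proof (induction "card X" arbitrary: X rule: less_induct)
  case less
  show ?case
  proof (cases "X = {}")
    case False
    then obtain x where x: "x \<in> X" by auto
    let ?Y = "X - {x, f x}"
    have sub: "{x, f x} \<subseteq> X" using less.prems x by auto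
    have "card {x, f x} = 2" using less.prems(4)[OF x] by auto
    then have c: "card X = card ?Y + 2"
      using sub less.prems(1) card_Diff_subset[of "{x, f x}" X] card_mono[of X "{x, f x}"] by auto
    have "f y \<in> ?Y" if "y \<in> ?Y" for y
      using that less.prems x by (metis Diff_iff insert_iff singletonD)
    then have "even (card ?Y)"
      using c less.prems by (intro less.hyps) auto
    then show ?thesis using c by simp
  qed auto
qed

lemma alternating_on_cong:
  "(\<And>x. x \<in> J \<Longrightarrow> g x = h x) \<Longrightarrow> alternating_on g J \<longleftrightarrow> alternating_on h J"
  using inj_on_cong[of J g h] image_cong[of J J g h] by (simp add: alternating_on_def)

text \<open>The prefixes of such a list form a maximal chain of signed sets: a facet of the barycentric
subdivision of the boundary of the cross-polytope.\<close>

definition signed_perms :: "nat \<Rightarrow> int list set" where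
  "signed_perms m = {l. distinct (map abs l) \<and> abs ` set l = {1..int m}}"

lemma length_signed_perms: "l \<in> signed_perms m \<Longrightarrow> length l = m"
  using distinct_card[of "map abs l"] by (auto simp: signed_perms_def)

lemma finite_signed_perms: "finite (signed_perms m)"
proof (rule finite_subset)
  have "x \<in> {- int m..int m}" if "\<bar>x\<bar> \<in> {1..int m}" for x using that by auto
  then have "set l \<subseteq> {- int m..int m}" if "l \<in> signed_perms m" for l
    using that unfolding signed_perms_def by blast
  then show "signed_perms m \<subseteq> {l. set l \<subseteq> {- int m..int m} \<and> length l = m}"
    using length_signed_perms by auto
  show "finite {l. set l \<subseteq> {- int m..int m} \<and> length l = m}"
    by (rule finite_lists_length_eq) simp
qed

lemma signed_perms_0: "signed_perms 0 = {[]}"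
  by (auto simp: signed_perms_def)

lemma map_uminus_signed_perms: "l \<in> signed_perms m \<Longrightarrow> map uminus l \<in> signed_perms m"
  by (simp add: signed_perms_def image_image comp_def)

lemma signed_perms_uminus_notin:
  assumes "l \<in> signed_perms m" "x \<in> set l" shows "- x \<notin> set l"
proof
  assume "- x \<in> set l"
  have "inj_on abs (set l)" using assms(1) by (simp add: signed_perms_def distinct_map)
  then have "x = - x" using inj_onD[of abs "set l" x "- x"] assms(2) \<open>- x \<in> set l\<close> by simp
  then have "\<bar>x\<bar> = 0" by simp
  moreover have "\<bar>x\<bar> \<in> {1..int m}" using assms by (auto simp: signed_perms_def)
  ultimately show False by simp
qed

lemma signed_perms_Suc_cases:
  assumes "l \<in> signed_perms (Suc m)"
  shows "int (Suc m) \<in> set l \<longleftrightarrow> - int (Suc m) \<notin> set l"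
proof -
  have "int (Suc m) \<in> abs ` set l" using assms by (simp add: signed_perms_def)
  then obtain x where "x \<in> set l" "\<bar>x\<bar> = int (Suc m)" by auto
  then have "x = int (Suc m) \<or> x = - int (Suc m)" by linarith
  then have "int (Suc m) \<in> set l \<or> - int (Suc m) \<in> set l" using \<open>x \<in> set l\<close> by blast
  then show ?thesis using signed_perms_uminus_notin[OF assms] by fastforce
qed

text \<open>A nonzero vector of \<open>{-1, 0, 1}\<^sup>n\<close> is encoded by the set of its signed coordinates \<open>\<plusminus>i\<close>.\<close>

definition signed_sets :: "nat \<Rightarrow> int set set" where
  "signed_sets n = {A. A \<noteq> {} \<and> abs ` A \<subseteq> {1..int n} \<and> A \<inter> uminus ` A = {}}"

lemma take_signed_perms:
  assumes "l \<in> signed_perms m" "m \<le> n" "j \<in> {1..m}"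
  shows "set (take j l) \<in> signed_sets n"
proof -
  have "set (take j l) \<noteq> {}" using assms length_signed_perms[OF assms(1)] by auto
  moreover have sub: "set (take j l) \<subseteq> set l" by (rule set_take_subset)
  then have "abs ` set (take j l) \<subseteq> abs ` set l" by (rule image_mono)
  then have "abs ` set (take j l) \<subseteq> {1..int n}" using assms by (auto simp: signed_perms_def)
  moreover have "set (take j l) \<inter> uminus ` set (take j l) = {}"
    using signed_perms_uminus_notin[OF assms(1)] sub by auto
  ultimately show ?thesis by (simp add: signed_sets_def)
qed

text \<open>The step to the neighbouring facet across the face opposite the \<open>j\<close>-th
  prefix: exchanging the 0-based positions \<open>j - 1\<close> and \<open>j\<close> changes no
  prefix set but the one of length \<open>j\<close>.\<close>

definition swap_at :: "nat \<Rightarrow> 'a list \<Rightarrow> 'a list" where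
  "swap_at j l = l[j - 1 := l ! j, j := l ! (j - 1)]"

lemma length_swap_at [simp]: "length (swap_at j l) = length l"
  by (simp add: swap_at_def)

lemma set_swap_at: "j < length l \<Longrightarrow> set (swap_at j l) = set l"
  by (simp add: swap_at_def)

lemma swap_at_swap_at: "1 \<le> j \<Longrightarrow> j < length l \<Longrightarrow> swap_at j (swap_at j l) = l"
  by (rule nth_equalityI) (auto simp: swap_at_def nth_list_update)

lemma set_take_swap_at:
  assumes "1 \<le> j" "j < length l" "k \<noteq> j"
  shows "set (take k (swap_at j l)) = set (take k l)"
proof (cases "k < j")
  case True
  then have "take k (swap_at j l) = take k l" by (simp add: swap_at_def)
  then show ?thesis by simp
next
  case False
  then have "take k (swap_at j l) = swap_at j (take k l)"
    using assms by (auto simp: swap_at_def take_update_swap)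
  then show ?thesis using False assms by (simp add: set_swap_at)
qed

lemma swap_at_signed_perms:
  assumes "l \<in> signed_perms m" "1 \<le> j" "j < m"
  shows "swap_at j l \<in> signed_perms m" "swap_at j l \<noteq> l"
proof -
  have len: "length l = m" using assms length_signed_perms by auto
  have "map abs (swap_at j l) = swap_at j (map abs l)"
    using assms len by (simp add: swap_at_def map_update)
  moreover have "distinct (swap_at j (map abs l))"
    using assms len unfolding swap_at_def by (subst distinct_swap) (auto simp: signed_perms_def)
  ultimately have "distinct (map abs (swap_at j l))" by simp
  then show "swap_at j l \<in> signed_perms m"
    using assms set_swap_at[of j l] len by (simp add: signed_perms_def)
  have "distinct l" using assms(1) by (simp add: signed_perms_def distinct_map)
  then have "l ! (j - 1) \<noteq> l ! j" using assms len by (simp add: nth_eq_iff_index_eq)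
  moreover have "swap_at j l ! j = l ! (j - 1)" using assms len by (simp add: swap_at_def)
  ultimately show "swap_at j l \<noteq> l" by auto
qed

text \<open>The neighbour across the face opposite the full prefix, the one case in which no entry
  is left to swap with.\<close>

definition flip_last :: "int list \<Rightarrow> int list" where
  "flip_last l = butlast l @ [- last l]"

lemma flip_last_signed_perms:
  assumes "l \<in> signed_perms (Suc m)"
  shows "flip_last l \<in> signed_perms (Suc m)" "flip_last (flip_last l) = l" "flip_last l \<noteq> l"
    "k \<le> m \<Longrightarrow> take k (flip_last l) = take k l"
proof -
  have len: "length l = Suc m" using assms by (rule length_signed_perms)
  then obtain b x where l: "l = b @ [x]" by (metis length_Suc_conv_rev)
  then have b: "length b = m" using len by simp
  have f: "flip_last l = b @ [- x]" by (simp add: flip_last_def l)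
  show "flip_last l \<in> signed_perms (Suc m)" using assms unfolding f by (auto simp: signed_perms_def l)
  show "flip_last (flip_last l) = l" by (simp add: flip_last_def l)
  have "\<bar>x\<bar> \<in> {1..int (Suc m)}" using assms l by (auto simp: signed_perms_def)
  then show "flip_last l \<noteq> l" unfolding f by (auto simp: l)
  show "take k (flip_last l) = take k l" if "k \<le> m" using that b unfolding f by (simp add: l)
qed

text \<open>Tucker's hypotheses on the barycentric subdivision, whose vertices are the signed sets
  and whose edges are the nested pairs.\<close>

locale antipodal_labelling =
  fixes lam :: "int set \<Rightarrow> int" and n :: nat
  assumes nonzero: "A \<in> signed_sets n \<Longrightarrow> lam A \<noteq> 0"
    and antipodal: "A \<in> signed_sets n \<Longrightarrow> lam (uminus ` A) = - lam A"
    and not_complementary: "A \<in> signed_sets n \<Longrightarrow> B \<in> signed_sets n \<Longrightarrow> A \<subseteq> B \<Longrightarrow> lam A \<noteq> - lam B"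
begin

definition prefix_label :: "int list \<Rightarrow> nat \<Rightarrow> int" where
  "prefix_label l j = lam (set (take j l))"

definition alternating_perms :: "nat \<Rightarrow> int list set" where
  "alternating_perms m = {l \<in> signed_perms m. alternating_on (prefix_label l) {1..m}}"

lemma prefix_label_not_complementary:
  assumes "l \<in> signed_perms m" "m \<le> n" "j \<in> {1..m}" "k \<in> {1..m}"
  shows "prefix_label l j \<noteq> - prefix_label l k"
proof -
  have s: "set (take j l) \<in> signed_sets n" "set (take k l) \<in> signed_sets n"
    using assms take_signed_perms by auto
  show ?thesis
  proof (cases "j \<le> k")
    case True
    then show ?thesis using not_complementary[OF s] set_take_subset_set_take[of j k l]
      by (simp add: prefix_label_def)
  next
    case False
    then have "lam (set (take k l)) \<noteq> - lam (set (take j l))"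
      using not_complementary[OF s(2,1)] set_take_subset_set_take[of k j l] by simp
    then show ?thesis by (simp add: prefix_label_def equation_minus_iff)
  qed
qed

text \<open>Ky Fan's parity argument. Let \<open>H\<close> be the facets of the upper hemisphere of dimension \<open>i\<close>. Count
the pairs of a facet in \<open>H\<close> and one of its vertices whose removal leaves an alternating face. By
facets, the number is congruent to that of alternating facets of the whole sphere. By faces, the
inner ones cancel in pairs, and the rest are the alternating facets of the equator.\<close>

lemma odd_card_alternating_perms: "m \<le> n \<Longrightarrow> odd (card (alternating_perms m))"
proof (induction m)
  case 0
  \<comment> \<open>The count starts from the empty list, the single facet of the empty sphere,
    which alternates vacuously.\<close>
  have "alternating_perms 0 = {[]}"
    by (auto simp: alternating_perms_def signed_perms_0 alternating_on_def alternating_def)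
  then show ?case by simp
next
  case (Suc i)
  let ?m = "Suc i"
  let ?J = "{1..?m}"
  define H where "H = {l \<in> signed_perms ?m. int ?m \<in> set l}"
  define F where "F j = {l \<in> H. alternating_on (prefix_label l) (?J - {j})}" for j
  define P where "P = {l \<in> H. alternating_on (prefix_label l) ?J}"
  define N where "N = {l \<in> H. alternating_on (\<lambda>j. - prefix_label l j) ?J}"
  have finH: "finite H" using finite_signed_perms by (simp add: H_def)
  have "even (card {j \<in> ?J. l \<in> F j} + of_bool (l \<in> P) + of_bool (l \<in> N))" if l: "l \<in> H" for l
  proof -
    have "even (card {j \<in> ?J. alternating_on (prefix_label l) (?J - {j})}) \<longleftrightarrow>
      (alternating_on (prefix_label l) ?J \<longleftrightarrow> alternating_on (\<lambda>j. - prefix_label l j) ?J)"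
    proof (rule even_card_alternating_on_facets)
      show "prefix_label l j \<noteq> 0" if "j \<in> ?J" for j
        using l take_signed_perms[of l ?m n j] nonzero that Suc.prems
        by (auto simp: H_def prefix_label_def)
      show "prefix_label l j \<noteq> - prefix_label l k" if "j \<in> ?J" "k \<in> ?J" for j k
        using prefix_label_not_complementary[of l ?m j k] l that Suc.prems by (simp add: H_def)
    qed simp
    then show ?thesis using l by (simp add: F_def P_def N_def)
  qed
  then have "even (\<Sum>l\<in>H. card {j \<in> ?J. l \<in> F j} + of_bool (l \<in> P) + of_bool (l \<in> N))"
    by (rule dvd_sum)
  moreover have "(\<Sum>l\<in>H. card {j \<in> ?J. l \<in> F j}) = (\<Sum>j\<in>?J. card (F j))"
  proof -
    have "(\<Sum>l\<in>H. card {j \<in> ?J. l \<in> F j}) = (\<Sum>j\<in>?J. card {l \<in> H. l \<in> F j})"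
      using sum.swap_restrict[of H ?J "\<lambda>_ _. 1::nat" "\<lambda>l j. l \<in> F j"] finH by simp
    also have "\<dots> = (\<Sum>j\<in>?J. card (F j))"
      by (intro sum.cong refl arg_cong[where f = card]) (auto simp: F_def)
    finally show ?thesis .
  qed
  moreover have "(\<Sum>l\<in>H. of_bool (l \<in> P)) = card P" "(\<Sum>l\<in>H. of_bool (l \<in> N)) = card N"
  proof -
    have "P \<subseteq> H" "N \<subseteq> H" by (auto simp: P_def N_def)
    then show "(\<Sum>l\<in>H. of_bool (l \<in> P)) = card P" "(\<Sum>l\<in>H. of_bool (l \<in> N)) = card N"
      using finH by (simp_all add: sum.inter_filter[symmetric] of_bool_def Int_absorb1 Collect_conj_eq flip: sum.inter_restrict)
  qed
  ultimately have total: "even ((\<Sum>j\<in>?J. card (F j)) + card P + card N)"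
    by (simp add: sum.distrib)
  \<comment> \<open>The antipodal map negates all labels, so \<open>N\<close> stands for the
    alternating facets of the lower hemisphere.\<close>
  have "card N = card {l \<in> signed_perms ?m - H. alternating_on (prefix_label l) ?J}" (is "_ = card ?N'")
  proof (rule bij_betw_same_card[of "map uminus"], rule bij_betw_byWitness[where f' = "map uminus"])
    have lab: "prefix_label (map uminus l) j = - prefix_label l j" if "l \<in> signed_perms ?m" "j \<in> ?J" for l j
      using antipodal[OF take_signed_perms[OF that(1) Suc.prems that(2)]]
      by (simp add: prefix_label_def take_map)
    have mem: "map uminus l \<in> H \<longleftrightarrow> l \<notin> H" if "l \<in> signed_perms ?m" for l
    proof -
      have "int ?m \<in> uminus ` set l \<longleftrightarrow> - int ?m \<in> set l" by (metis image_iff minus_minus)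
      then show ?thesis
        using signed_perms_Suc_cases[OF that] that map_uminus_signed_perms[OF that]
        unfolding H_def set_map mem_Collect_eq by blast
    qed
    show "map uminus ` N \<subseteq> ?N'"
    proof
      fix l' assume "l' \<in> map uminus ` N"
      then obtain l where l: "l \<in> N" "l' = map uminus l" by auto
      then have sp: "l \<in> signed_perms ?m" by (simp add: N_def H_def)
      have "alternating_on (prefix_label l') ?J"
        using l lab[OF sp] alternating_on_cong[of ?J "prefix_label l'" "\<lambda>j. - prefix_label l j"]
        by (simp add: N_def)
      then show "l' \<in> ?N'" using l mem[OF sp] map_uminus_signed_perms[OF sp] by (simp add: N_def)
    qed
    show "map uminus ` ?N' \<subseteq> N"
    proof
      fix l' assume "l' \<in> map uminus ` ?N'"
      then obtain l where l: "l \<in> ?N'" "l' = map uminus l" by auto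
      then have sp: "l \<in> signed_perms ?m" by simp
      have "alternating_on (\<lambda>j. - prefix_label l' j) ?J"
        using l lab[OF sp] alternating_on_cong[of ?J "\<lambda>j. - prefix_label l' j" "prefix_label l"]
        by simp
      then show "l' \<in> N" using l mem[OF sp] by (simp add: N_def)
    qed
  qed (auto simp: comp_def)
  moreover have "alternating_perms ?m = P \<union> ?N'"
    by (auto simp: alternating_perms_def P_def H_def)
  moreover have "card (P \<union> ?N') = card P + card ?N'"
    using finH finite_signed_perms by (intro card_Un_disjoint) (auto simp: P_def)
  ultimately have PN: "card P + card N = card (alternating_perms ?m)" by simp
  \<comment> \<open>Inner faces: a swap keeps the set of signed entries, so the neighbouring facet
    stays in \<open>H\<close> and the two cancel.\<close>
  have "even (card (F j))" if j: "j \<in> {1..i}" for j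
  proof (rule even_card_involution[of _ "swap_at j"])
    show "finite (F j)" using finH by (simp add: F_def)
    fix l assume l: "l \<in> F j"
    then have sp: "l \<in> signed_perms ?m" by (simp add: F_def H_def)
    then have len: "length l = ?m" by (rule length_signed_perms)
    show "swap_at j (swap_at j l) = l" using j len by (intro swap_at_swap_at) auto
    show "swap_at j l \<noteq> l" using swap_at_signed_perms[OF sp, of j] j by simp
    have "prefix_label (swap_at j l) k = prefix_label l k" if "k \<in> ?J - {j}" for k
      using set_take_swap_at[of j l k] that j len by (simp add: prefix_label_def)
    then have "alternating_on (prefix_label (swap_at j l)) (?J - {j})"
      using l alternating_on_cong[of "?J - {j}" "prefix_label (swap_at j l)" "prefix_label l"]
      by (simp add: F_def)
    then show "swap_at j l \<in> F j"
      using l swap_at_signed_perms[OF sp, of j] j set_swap_at[of j l] len by (simp add: F_def H_def)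
  qed
  then have "even (\<Sum>j\<in>{1..i}. card (F j))" by (rule dvd_sum)
  moreover have "(\<Sum>j\<in>?J. card (F j)) = (\<Sum>j\<in>{1..i}. card (F j)) + card (F ?m)" by simp
  ultimately have F: "even (\<Sum>j\<in>?J. card (F j)) \<longleftrightarrow> even (card (F ?m))" by simp
  have J: "?J - {?m} = {1..i}" "{Suc 0..Suc i} - {Suc i} = {Suc 0..i}" by auto
  \<comment> \<open>The face opposite the last prefix ignores the last entry. Unless that entry is
    \<open>int ?m\<close>, its sign can be flipped inside \<open>H\<close>; if it is, the face lies
    in the equator and is a facet one dimension lower.\<close>
  define F0 where "F0 = {l \<in> F ?m. last l \<noteq> int ?m}"
  define F1 where "F1 = {l \<in> F ?m. last l = int ?m}"
  have "even (card F0)"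
  proof (rule even_card_involution[of _ flip_last])
    show "finite F0" using finH by (simp add: F0_def F_def)
    fix l assume l: "l \<in> F0"
    then have sp: "l \<in> signed_perms ?m" by (simp add: F0_def F_def H_def)
    note flip = flip_last_signed_perms[OF sp]
    show "flip_last (flip_last l) = l" "flip_last l \<noteq> l" by (rule flip)+
    have "prefix_label (flip_last l) k = prefix_label l k" if "k \<in> {1..i}" for k
      using flip(4) that by (simp add: prefix_label_def)
    then have "alternating_on (prefix_label (flip_last l)) {1..i}"
      using l alternating_on_cong[of "{1..i}" "prefix_label (flip_last l)" "prefix_label l"]
      by (simp add: F0_def F_def J)
    moreover have "l \<noteq> []" using length_signed_perms[OF sp] by auto
    then have "set l = insert (last l) (set (butlast l))"
      by (cases l rule: rev_cases) auto
    then have m: "int ?m \<in> set (butlast l)" using l by (auto simp: F0_def F_def H_def)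
    have "last (flip_last l) \<noteq> int ?m"
    proof
      assume "last (flip_last l) = int ?m"
      then have "last l = - int ?m" by (simp add: flip_last_def)
      then have "- int ?m \<in> set l" using last_in_set[OF \<open>l \<noteq> []\<close>] by simp
      then show False using signed_perms_Suc_cases[OF sp] m in_set_butlastD by fast
    qed
    ultimately show "flip_last l \<in> F0" using flip(1) m by (simp add: F0_def F_def H_def J flip_last_def)
  qed
  moreover have "card F1 = card (alternating_perms i)"
  proof (rule bij_betw_same_card[of butlast], rule bij_betw_byWitness[where f' = "\<lambda>l. l @ [int ?m]"])
    have ne: "l \<noteq> []" if "l \<in> F1" for l
      using that length_signed_perms[of l ?m] by (auto simp: F1_def F_def H_def)
    show "\<forall>l\<in>F1. butlast l @ [int ?m] = l"
      using ne by (metis (mono_tags, lifting) F1_def append_butlast_last_id mem_Collect_eq)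
    have sp: "l @ [int ?m] \<in> signed_perms ?m \<longleftrightarrow> l \<in> signed_perms i" for l
    proof
      assume a: "l @ [int ?m] \<in> signed_perms ?m"
      then have "insert (int ?m) (abs ` set l) = {1..int ?m}" "int ?m \<notin> abs ` set l" "distinct (map abs l)"
        by (auto simp: signed_perms_def)
      moreover from this have "abs ` set l = {1..int ?m} - {int ?m}" by blast
      moreover have "{1..int ?m} - {int ?m} = {1..int i}" by auto
      ultimately show "l \<in> signed_perms i" by (simp add: signed_perms_def)
    next
      assume a: "l \<in> signed_perms i"
      then have "int ?m \<notin> abs ` set l" by (simp add: signed_perms_def)
      moreover have "insert (int ?m) {1..int i} = {1..int ?m}" by auto
      ultimately show "l @ [int ?m] \<in> signed_perms ?m" using a
        by (auto simp: signed_perms_def)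
    qed
    have alt: "alternating_on (prefix_label (l @ [int ?m])) {1..i} \<longleftrightarrow> alternating_on (prefix_label l) {1..i}"
      if "length l = i" for l
      using that by (intro alternating_on_cong) (simp add: prefix_label_def)
    show "butlast ` F1 \<subseteq> alternating_perms i"
    proof
      fix l' assume "l' \<in> butlast ` F1"
      then obtain l where l: "l \<in> F1" "l' = butlast l" by auto
      then have eq: "l = l' @ [int ?m]" using ne[of l] by (metis (mono_tags, lifting) F1_def append_butlast_last_id mem_Collect_eq)
      have "l \<in> signed_perms ?m" "alternating_on (prefix_label l) {1..i}"
        using l(1) unfolding F1_def F_def H_def J by auto
      then have "l' \<in> signed_perms i" "alternating_on (prefix_label l') {1..i}"
        using sp[of l'] alt[of l'] length_signed_perms[of l' i] unfolding eq by blast+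
      then show "l' \<in> alternating_perms i" by (simp add: alternating_perms_def)
    qed
    show "(\<lambda>l. l @ [int ?m]) ` alternating_perms i \<subseteq> F1"
    proof
      fix l' assume "l' \<in> (\<lambda>l. l @ [int ?m]) ` alternating_perms i"
      then obtain l where l: "l \<in> alternating_perms i" "l' = l @ [int ?m]" by auto
      then have "l \<in> signed_perms i" "alternating_on (prefix_label l) {1..i}"
        by (auto simp: alternating_perms_def)
      then have "l' \<in> signed_perms ?m" "alternating_on (prefix_label l') {1..i}"
        using sp[of l] alt[of l] length_signed_perms[of l i] l(2) by blast+
      then show "l' \<in> F1" using l(2) unfolding F1_def F_def H_def J by simp
    qed
  qed simp
  moreover have "card (F ?m) = card F0 + card F1"
  proof -
    have "F ?m = F0 \<union> F1" by (auto simp: F0_def F1_def)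
    moreover have "finite F0" "finite F1" "F0 \<inter> F1 = {}" using finH by (auto simp: F0_def F1_def F_def)
    ultimately show ?thesis by (simp add: card_Un_disjoint)
  qed
  ultimately have "odd (card (F ?m))" using Suc by simp
  moreover have "even ((\<Sum>j\<in>?J. card (F j)) + card (alternating_perms ?m))"
    using total unfolding PN[symmetric] by (simp only: add.assoc)
  ultimately show ?case using F by (simp only: even_add) blast
qed

text \<open>The odd count provides an alternating facet. Its \<open>n\<close> labels are distinct
  and no two are opposite, so their absolute values are \<open>n\<close> distinct numbers in
  \<open>{1..m}\<close>.\<close>

theorem octahedral_Tucker:
  assumes "\<And>A. A \<in> signed_sets n \<Longrightarrow> \<bar>lam A\<bar> \<le> int m"
  shows "n \<le> m"
proof -
  obtain l where l: "l \<in> signed_perms n" "alternating_on (prefix_label l) {1..n}"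
  proof -
    have "odd (card (alternating_perms n))" by (rule odd_card_alternating_perms) simp
    then have "alternating_perms n \<noteq> {}" by (metis card.empty even_zero)
    then show ?thesis using that unfolding alternating_perms_def by blast
  qed
  have "inj_on (\<lambda>j. \<bar>prefix_label l j\<bar>) {1..n}"
  proof (rule inj_onI)
    fix j k assume jk: "j \<in> {1..n}" "k \<in> {1..n}" "\<bar>prefix_label l j\<bar> = \<bar>prefix_label l k\<bar>"
    then have "prefix_label l j = prefix_label l k"
      using prefix_label_not_complementary[OF l(1), of j k] by (auto simp: abs_eq_iff)
    then show "j = k" using l(2) jk by (auto simp: alternating_on_def dest: inj_onD)
  qed
  moreover have "(\<lambda>j. \<bar>prefix_label l j\<bar>) ` {1..n} \<subseteq> {1..int m}"
  proof
    fix y assume "y \<in> (\<lambda>j. \<bar>prefix_label l j\<bar>) ` {1..n}"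
    then obtain j where j: "j \<in> {1..n}" "y = \<bar>prefix_label l j\<bar>" by auto
    have "set (take j l) \<in> signed_sets n" using take_signed_perms[OF l(1) _ j(1)] by simp
    then show "y \<in> {1..int m}" using assms nonzero j(2) by (force simp: prefix_label_def)
  qed
  ultimately have "card {1..n} \<le> card {1..int m}" by (metis card_inj_on_le finite_atLeastAtMost_int)
  then show ?thesis by simp
qed

end

section \<open>Colourings of the cube\<close>

lemma finite_signed_sets: "A \<in> signed_sets n \<Longrightarrow> finite A"
proof -
  assume "A \<in> signed_sets n"
  then have sub: "abs ` A \<subseteq> {1..int n}" by (simp add: signed_sets_def)
  have "A \<subseteq> {- int n..int n}"
  proof
    fix x assume "x \<in> A"
    then have "\<bar>x\<bar> \<in> {1..int n}" using sub by blast
    then show "x \<in> {- int n..int n}" by auto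
  qed
  then show "finite A" by (rule finite_subset) simp
qed

lemma signed_sets_parts:
  assumes "A \<in> signed_sets n"
  shows "A \<inter> {1..int n} \<union> uminus ` A \<inter> {1..int n} = abs ` A" "card (abs ` A) = card A"
proof -
  have A: "abs ` A \<subseteq> {1..int n}" "A \<inter> uminus ` A = {}" using assms by (auto simp: signed_sets_def)
  show "A \<inter> {1..int n} \<union> uminus ` A \<inter> {1..int n} = abs ` A"
  proof (intro equalityI subsetI)
    fix x assume "x \<in> abs ` A"
    then obtain y where "y \<in> A" "x = \<bar>y\<bar>" by auto
    then have "x \<in> A \<or> x \<in> uminus ` A" by (cases "y \<ge> 0") auto
    then show "x \<in> A \<inter> {1..int n} \<union> uminus ` A \<inter> {1..int n}" using \<open>x \<in> abs ` A\<close> A(1) by blast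
  next
    fix x assume "x \<in> A \<inter> {1..int n} \<union> uminus ` A \<inter> {1..int n}"
    then have "x > 0" "x \<in> A \<or> - x \<in> A" by (auto simp: image_iff)
    moreover from this have "x = \<bar>x\<bar>" "x = \<bar>- x\<bar>" by auto
    ultimately show "x \<in> abs ` A" by (metis image_eqI)
  qed
  have "inj_on abs A"
  proof (rule inj_onI)
    fix x y assume xy: "x \<in> A" "y \<in> A" "\<bar>x\<bar> = \<bar>y\<bar>"
    then have "x = y \<or> x = - y" by (simp add: abs_eq_iff)
    then show "x = y" using xy A(2) by blast
  qed
  then show "card (abs ` A) = card A" by (rule card_image)
qed

text \<open>The sign of the coordinate of largest index, as a canonical sign that changes under the
  antipodal map.\<close>

definition top_sign :: "int set \<Rightarrow> int" where
  "top_sign A = (if Max (abs ` A) \<in> A then 1 else - 1)"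

lemma top_sign_uminus:
  assumes "A \<in> signed_sets n" shows "top_sign (uminus ` A) = - top_sign A"
proof -
  have "Max (abs ` A) \<in> abs ` A"
    using assms finite_signed_sets[OF assms] by (intro Max_in) (auto simp: signed_sets_def)
  then have "Max (abs ` A) \<in> A \<union> uminus ` A" using signed_sets_parts(1)[OF assms] by blast
  moreover have "A \<inter> uminus ` A = {}" using assms by (simp add: signed_sets_def)
  ultimately show ?thesis by (auto simp: top_sign_def image_image)
qed

text \<open>Otherwise label a small signed set by its size, and a large one by the smaller of the colours of
its positive and negative part, shifted beyond the sizes: this contradicts Tucker's lemma.\<close>

lemma same_colour_distant_subsets:
  fixes c :: "int set \<Rightarrow> nat"
  assumes "k \<le> d" and c: "\<And>X. X \<subseteq> {1..int d} \<Longrightarrow> c X < k"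
  obtains X Y where "X \<subseteq> {1..int d}" "Y \<subseteq> {1..int d}" "c X = c Y" "d < card ((X - Y) \<union> (Y - X)) + k"
proof (rule ccontr)
  assume "\<not> thesis"
  define I where "I = {1..int d}"
  have far: "c X \<noteq> c Y"
    if "X \<subseteq> I" "Y \<subseteq> I" "X \<inter> Y = {}" "A \<in> signed_sets d" "abs ` A \<subseteq> X \<union> Y" "d - k < card A" for X Y A
  proof
    assume eq: "c X = c Y"
    have "finite (X \<union> Y)" using that(1,2) by (auto simp: I_def intro: finite_subset)
    then have "card A \<le> card (X \<union> Y)"
      using that(5) card_mono[of "X \<union> Y" "abs ` A"] signed_sets_parts(2)[OF that(4)] by simp
    moreover have "(X - Y) \<union> (Y - X) = X \<union> Y" using that(3) by blast
    ultimately have "d < card ((X - Y) \<union> (Y - X)) + k" using that(6) by simp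
    then show False using eq that(1,2) \<open>\<not> thesis\<close> \<open>\<And>X Y. \<lbrakk>X \<subseteq> {1..int d}; Y \<subseteq> {1..int d}; c X = c Y; d < card ((X - Y) \<union> (Y - X)) + k\<rbrakk> \<Longrightarrow> thesis\<close>
      unfolding I_def by blast
  qed
  define p where "p A = c (A \<inter> I)" for A
  define lam where "lam A = (if card A \<le> d - k then top_sign A * int (card A)
    else if p A < p (uminus ` A) then int (d - k + 1 + p A) else - int (d - k + 1 + p (uminus ` A)))" for A
  have "k > 0" using c[of "{}"] by simp
  have p_less: "p A < k" for A using c[of "A \<inter> I"] by (simp add: p_def I_def)
  \<comment> \<open>For nested sets, the positive part of one and the negative part of the other are
    disjoint and together cover the support of \<open>A\<close>. Opposite large labels would give
    these two parts the same colour.\<close>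
  have p_neq: "p A \<noteq> p (uminus ` B)" "p B \<noteq> p (uminus ` A)"
    if "A \<in> signed_sets d" "B \<in> signed_sets d" "A \<subseteq> B" "d - k < card A" for A B
  proof -
    have AB: "abs ` A \<subseteq> A \<inter> I \<union> uminus ` A \<inter> I" "B \<inter> uminus ` B = {}"
      using signed_sets_parts(1)[OF that(1)] that(2) by (simp_all add: signed_sets_def I_def)
    show "p A \<noteq> p (uminus ` B)" unfolding p_def using AB that(3)
      by (intro far[OF _ _ _ that(1) _ that(4)]) blast+
    show "p B \<noteq> p (uminus ` A)" unfolding p_def using AB that(3)
      by (intro far[OF _ _ _ that(1) _ that(4)]) blast+
  qed
  have pos: "card A > 0" if "A \<in> signed_sets d" for A
    using that finite_signed_sets[OF that] by (auto simp: signed_sets_def card_gt_0_iff)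
  have abs_small: "\<bar>lam A\<bar> = int (card A)" if "card A \<le> d - k" for A
    using that by (simp add: lam_def top_sign_def)
  have card_uminus: "card (uminus ` A) = card A" for A :: "int set" by (simp add: card_image)
  have nonzero: "lam A \<noteq> 0" if "A \<in> signed_sets d" for A
    using pos[OF that] by (simp add: lam_def top_sign_def)
  have antipodal: "lam (uminus ` A) = - lam A" if "A \<in> signed_sets d" for A
  proof -
    have "p A \<noteq> p (uminus ` A)" if "\<not> card A \<le> d - k"
      using p_neq(1)[of A A] \<open>A \<in> signed_sets d\<close> that by simp
    then have "card A \<le> d - k \<or> p A < p (uminus ` A) \<or> p (uminus ` A) < p A" by linarith
    then show ?thesis
      using top_sign_uminus[OF that] card_uminus[of A] by (auto simp: lam_def image_image)
  qed
  interpret antipodal_labelling lam d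
  proof
    fix A B assume AB: "A \<in> signed_sets d" "B \<in> signed_sets d" "A \<subseteq> B"
    have le: "card A \<le> card B" using AB(3) finite_signed_sets[OF AB(2)] by (rule card_mono[rotated])
    show "lam A \<noteq> - lam B"
    proof
      assume eq: "lam A = - lam B"
      consider "card B \<le> d - k" | "card A \<le> d - k" "\<not> card B \<le> d - k" | "\<not> card A \<le> d - k" "\<not> card B \<le> d - k"
        by linarith
      then show False
      proof cases
        case 1
        then have "card A = card B" using eq abs_small[of A] abs_small[of B] le by simp
        then have "A = B" using AB(3) finite_signed_sets[OF AB(2)] by (simp add: card_subset_eq)
        then show False using eq nonzero[OF AB(1)] by simp
      next
        case 2
        then have "\<bar>lam B\<bar> > int (d - k)" by (simp add: lam_def)
        then show False using eq 2 abs_small[of A] by simp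
      next
        case 3
        then show False using eq p_neq[OF AB] by (auto simp: lam_def split: if_splits)
      qed
    qed
  qed (use nonzero antipodal in auto)
  \<comment> \<open>The smaller of two distinct colours below \<open>k\<close> is at most
    \<open>k - 2\<close>, so large sets get labels up to \<open>d - k + 1 + (k - 2) = d - 1\<close>,
    one less than Tucker's lemma permits.\<close>
  have "d \<le> d - 1"
  proof (rule octahedral_Tucker)
    fix A assume A: "A \<in> signed_sets d"
    show "\<bar>lam A\<bar> \<le> int (d - 1)"
    proof (cases "card A \<le> d - k")
      case True
      then show ?thesis using abs_small[of A] \<open>k > 0\<close> assms(1) by simp
    next
      case False
      then have "p A \<noteq> p (uminus ` A)" using p_neq(1)[of A A] A by simp
      then show ?thesis using False p_less[of A] p_less[of "uminus ` A"] assms(1)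
        by (auto simp: lam_def)
    qed
  qed
  then show False using \<open>k > 0\<close> assms(1) by simp
qed

section \<open>Phases and majorities\<close>

text \<open>The line is cut into intervals of length \<open>R\<close> of alternating phase, with margins of width \<open>D\<close> removed.\<close>

definition in_phase :: "int \<Rightarrow> int \<Rightarrow> bool \<Rightarrow> int \<Rightarrow> bool" where
  "in_phase R D p z \<longleftrightarrow> (\<exists>q. (even q \<longleftrightarrow> p) \<and> q * R + D \<le> z \<and> z < (q + 1) * R - D)"

text \<open>The margins absorb the error of at most \<open>D\<close>, so \<open>z + w\<close> lies
  exactly \<open>k\<close> intervals beyond \<open>z\<close>.\<close>

lemma in_phase_shift:
  assumes "R > 0" "in_phase R D p z" "in_phase R D p' (z + w)" "\<bar>w - k * R\<bar> \<le> D"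
  shows "p = p' \<longleftrightarrow> even k"
proof -
  obtain q where q: "even q \<longleftrightarrow> p" "q * R + D \<le> z" "z < (q + 1) * R - D"
    using assms(2) by (auto simp: in_phase_def)
  obtain q' where q': "even q' \<longleftrightarrow> p'" "q' * R + D \<le> z + w" "z + w < (q' + 1) * R - D"
    using assms(3) by (auto simp: in_phase_def)
  have "q' * R < (q + k + 1) * R"
    using q q' assms(4) unfolding distrib_right by linarith
  moreover have "(q + k) * R < (q' + 1) * R"
    using q q' assms(4) unfolding distrib_right by linarith
  ultimately have "q' < q + k + 1" "q + k < q' + 1"
    using assms(1) by (simp_all only: mult_less_cancel_right_pos)
  then have "q' = q + k" by linarith
  then show ?thesis using q(1) q'(1) by auto
qed

section \<open>Periodic sets and counts over a period\<close>

definition periodic :: "int \<Rightarrow> int set \<Rightarrow> bool" where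
  "periodic Q A \<longleftrightarrow> (\<forall>z. z + Q \<in> A \<longleftrightarrow> z \<in> A)"

lemma periodic_mult:
  assumes "periodic Q A" shows "z + k * Q \<in> A \<longleftrightarrow> z \<in> A"
proof (induction k arbitrary: z rule: int_induct[where k = 0])
  case (step1 i)
  have "z + (i + 1) * Q \<in> A \<longleftrightarrow> (z + i * Q) + Q \<in> A" by (simp add: algebra_simps)
  then show ?case using assms step1 by (simp add: periodic_def)
next
  case (step2 i)
  have "z + (i - 1) * Q \<in> A \<longleftrightarrow> (z + (i - 1) * Q) + Q \<in> A" using assms by (simp add: periodic_def)
  also have "(z + (i - 1) * Q) + Q = z + i * Q" by (simp add: algebra_simps)
  finally show ?case using step2 by simp
qed simp

lemma periodic_dvd: "periodic Q A \<Longrightarrow> Q dvd s \<Longrightarrow> z + s \<in> A \<longleftrightarrow> z \<in> A"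
  using periodic_mult[of Q A z] by (auto elim!: dvdE simp: mult.commute)

lemma periodic_mono: "periodic Q A \<Longrightarrow> Q dvd Q' \<Longrightarrow> periodic Q' A"
  using periodic_dvd by (auto simp: periodic_def)

lemma periodic_mod: "periodic Q A \<Longrightarrow> z mod Q \<in> A \<longleftrightarrow> z \<in> A"
  using periodic_mult[of Q A "z mod Q" "z div Q"] by simp

lemma bij_betw_shift_mod:
  fixes Q :: int
  assumes "Q > 0" shows "bij_betw (\<lambda>t. (t + c) mod Q) {0..<Q} {0..<Q}"
proof (rule bij_betw_byWitness[where f' = "\<lambda>t. (t - c) mod Q"])
  show "\<forall>a\<in>{0..<Q}. ((a + c) mod Q - c) mod Q = a" by (auto simp: mod_simps)
  show "\<forall>a\<in>{0..<Q}. ((a - c) mod Q + c) mod Q = a" by (auto simp: mod_simps)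
qed (use assms in auto)

lemma card_periodic_shift:
  assumes "Q > 0" "periodic Q A"
  shows "card {t \<in> {0..<Q}. t + c \<in> A} = card (A \<inter> {0..<Q})"
proof (rule bij_betw_same_card)
  have "bij_betw (\<lambda>t. (t + c) mod Q) {t \<in> {0..<Q}. (t + c) mod Q \<in> A} {t \<in> {0..<Q}. t \<in> A}"
    by (rule bij_betw_Collect[OF bij_betw_shift_mod[OF assms(1)]]) simp
  then show "bij_betw (\<lambda>t. (t + c) mod Q) {t \<in> {0..<Q}. t + c \<in> A} (A \<inter> {0..<Q})"
    by (simp add: periodic_mod[OF assms(2)] Int_def conj_commute)
qed

lemma periodic_in_phase: "periodic (2 * R) (Collect (in_phase R D p))"
proof -
  have "in_phase R D p (z + 2 * R) \<longleftrightarrow> in_phase R D p z" for z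
  proof
    assume "in_phase R D p (z + 2 * R)"
    then obtain q where "even q \<longleftrightarrow> p" "q * R + D \<le> z + 2 * R" "z + 2 * R < (q + 1) * R - D"
      by (auto simp: in_phase_def)
    then show "in_phase R D p z" unfolding in_phase_def
      by (intro exI[of _ "q - 2"]) (auto simp: algebra_simps)
  next
    assume "in_phase R D p z"
    then obtain q where "even q \<longleftrightarrow> p" "q * R + D \<le> z" "z < (q + 1) * R - D"
      by (auto simp: in_phase_def)
    then show "in_phase R D p (z + 2 * R)" unfolding in_phase_def
      by (intro exI[of _ "q + 2"]) (auto simp: algebra_simps)
  qed
  then show ?thesis by (simp add: periodic_def)
qed

lemma card_in_phase:
  assumes "R > 0" "D \<ge> 0" "2 * D \<le> R"
  shows "card {t \<in> {0..<2 * R}. in_phase R D p (t + c)} = nat (R - 2 * D)"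
proof -
  define a where "a = (if p then 0 else R)"
  have a: "in_phase R D p z \<longleftrightarrow> a + D \<le> z \<and> z < a + R - D" if z: "z \<in> {0..<2 * R}" for z
  proof
    assume "in_phase R D p z"
    then obtain q where q: "even q \<longleftrightarrow> p" "q * R + D \<le> z" "z < (q + 1) * R - D"
      by (auto simp: in_phase_def)
    have "0 * R < (q + 1) * R" "q * R < 2 * R"
      using q z assms unfolding mult_zero_left atLeastLessThan_iff by linarith+
    then have "0 < q + 1" "q < 2" using assms(1) by (simp_all only: mult_less_cancel_right_pos)
    then have "q = (if p then 0 else 1)" using q(1) by (cases "q = 0"; cases "q = 1") auto
    then show "a + D \<le> z \<and> z < a + R - D" using q(2,3) by (auto simp: a_def)
  next
    assume "a + D \<le> z \<and> z < a + R - D"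
    then show "in_phase R D p z" unfolding in_phase_def a_def
      by (intro exI[of _ "if p then 0 else 1"]) auto
  qed
  have "card {t \<in> {0..<2 * R}. in_phase R D p (t + c)} = card (Collect (in_phase R D p) \<inter> {0..<2 * R})"
    using card_periodic_shift[OF _ periodic_in_phase[of R D p], of c] assms(1) by simp
  also have "Collect (in_phase R D p) \<inter> {0..<2 * R} = {a + D..<a + R - D}"
    using a assms by (auto simp: a_def)
  finally show ?thesis by simp
qed

text \<open>An elementary form of the order \<open>4 ^ m / sqrt m\<close> of the central binomial
  coefficient. The factor \<open>2 * m + 1\<close> reduces the induction step to
  \<open>(2 * m + 1) * (2 * m + 3) \<le> (2 * m + 2)\<^sup>2\<close>.\<close>

lemma central_binomial_square_le: "(real (2 * m choose m))\<^sup>2 * (2 * real m + 1) \<le> 16 ^ m"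
proof (induction m)
  case (Suc m)
  have "real (2 * Suc m choose Suc m) * (real m + 1) = real (2 * m choose m) * (2 * (2 * real m + 1))"
  proof -
    have "(2 * Suc m choose Suc m) * Suc m = Suc (2 * m + 1) * (2 * m + 1 choose m)"
      using Suc_times_binomial_eq[of "2 * m + 1" m] by simp
    also have "(2 * m + 1 choose m) = (2 * m + 1 choose Suc m)"
      using binomial_symmetric[of m "2 * m + 1"] by simp
    also have "Suc (2 * m + 1) * (2 * m + 1 choose Suc m) = 2 * (Suc (2 * m) * (2 * m choose m))"
      using Suc_times_binomial_eq[of "2 * m" m] by (simp add: algebra_simps)
    finally have "real ((2 * Suc m choose Suc m) * Suc m) = real (2 * (Suc (2 * m) * (2 * m choose m)))"
      by (rule arg_cong)
    then show ?thesis by (simp add: algebra_simps del: binomial_Suc_Suc)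
  qed
  then have "real (2 * Suc m choose Suc m) = real (2 * m choose m) * (2 * (2 * real m + 1) / (real m + 1))"
    by (simp add: field_simps)
  then have "(real (2 * Suc m choose Suc m))\<^sup>2 * (2 * real (Suc m) + 1) =
      ((real (2 * m choose m))\<^sup>2 * (2 * real m + 1)) * (4 * ((2 * real m + 1) * (2 * real m + 3)) / (real m + 1)\<^sup>2)"
  proof -
    have "(C * (2 * (2 * x + 1) / (x + 1)))\<^sup>2 * (2 * (x + 1) + 1) =
        (C\<^sup>2 * (2 * x + 1)) * (4 * ((2 * x + 1) * (2 * x + 3)) / (x + 1)\<^sup>2)" if "x \<ge> 0" for C x :: real
      using that by (simp add: power2_eq_square divide_simps) (simp add: algebra_simps)
    moreover have "real (Suc m) = real m + 1" by simp
    ultimately show ?thesis unfolding \<open>real (2 * Suc m choose Suc m) = _\<close> by simp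
  qed
  also have "\<dots> \<le> 16 ^ m * 16"
  proof (rule mult_mono[OF Suc])
    have "(2 * real m + 1) * (2 * real m + 3) \<le> 4 * (real m + 1)\<^sup>2"
      by (simp add: power2_eq_square algebra_simps)
    then show "4 * ((2 * real m + 1) * (2 * real m + 3)) / (real m + 1)\<^sup>2 \<le> 16"
      by (simp add: divide_simps)
  qed auto
  finally show ?case by simp
qed simp

lemma central_binomial_ratio_tendsto_0: "(\<lambda>m. real (2 * m choose m) / 4 ^ m) \<longlonglongrightarrow> 0"
proof (rule tendsto_sandwich[OF _ _ tendsto_const])
  show "\<forall>\<^sub>F m in sequentially. 0 \<le> real (2 * m choose m) / 4 ^ m" by simp
  show "\<forall>\<^sub>F m in sequentially. real (2 * m choose m) / 4 ^ m \<le> sqrt (inverse (real (Suc m)))"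
  proof (rule always_eventually, rule allI)
    fix m
    have "(4 ^ m)\<^sup>2 = (16 :: real) ^ m" by (simp add: power2_eq_square flip: power_mult_distrib)
    then have "(real (2 * m choose m) / 4 ^ m)\<^sup>2 \<le> 1 / (2 * real m + 1)"
      using central_binomial_square_le[of m]
      by (simp add: power_divide pos_le_divide_eq pos_divide_le_eq)
    also have "\<dots> \<le> inverse (real (Suc m))" by (simp add: field_simps)
    finally show "real (2 * m choose m) / 4 ^ m \<le> sqrt (inverse (real (Suc m)))"
      by (rule real_le_rsqrt)
  qed
  show "(\<lambda>m. sqrt (inverse (real (Suc m)))) \<longlonglongrightarrow> 0"
    using tendsto_real_sqrt[OF LIMSEQ_inverse_real_of_nat] by simp
qed

text \<open>Complementation matches clear majorities \<open>U\<close> with clear minorities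
  \<open>L\<close>. The undecided sets in \<open>N\<close> have at most \<open>2 * k + 1\<close>
  sizes, each taken by at most a central binomial number of sets.\<close>

lemma card_majority_subsets:
  assumes "finite I" "card I = 2 * m"
  shows "2 ^ (2 * m) \<le> 2 * card {P \<in> Pow I. 2 * m + k < 2 * card P} + (2 * k + 1) * (2 * m choose m)"
proof -
  define U where "U = {P \<in> Pow I. 2 * m + k < 2 * card P}"
  define L where "L = {P \<in> Pow I. 2 * card P + k < 2 * m}"
  define N where "N = {P \<in> Pow I. 2 * card P + k \<ge> 2 * m \<and> 2 * card P \<le> 2 * m + k}"
  have fin: "finite U" "finite L" "finite N" using assms by (simp_all add: U_def L_def N_def)
  have compl: "card (I - P) + card P = 2 * m" if "P \<subseteq> I" for P
    using assms that by (metis card_Diff_subset card_mono finite_subset le_add_diff_inverse2)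
  have "card L = card U"
  proof (rule bij_betw_same_card[of "\<lambda>P. I - P"], rule bij_betw_byWitness[where f' = "\<lambda>P. I - P"])
    show "(\<lambda>P. I - P) ` L \<subseteq> U"
    proof
      fix Q assume "Q \<in> (\<lambda>P. I - P) ` L"
      then obtain P where "P \<in> L" "Q = I - P" by auto
      then show "Q \<in> U" using compl[of P] by (auto simp: L_def U_def)
    qed
    show "(\<lambda>P. I - P) ` U \<subseteq> L"
    proof
      fix Q assume "Q \<in> (\<lambda>P. I - P) ` U"
      then obtain P where "P \<in> U" "Q = I - P" by auto
      then show "Q \<in> L" using compl[of P] by (auto simp: L_def U_def)
    qed
  qed (auto simp: L_def U_def)
  have "card N \<le> (2 * k + 1) * (2 * m choose m)"
  proof -
    have "N \<subseteq> (\<Union>v\<in>{m - k..m + k}. {P. P \<subseteq> I \<and> card P = v})" by (auto simp: N_def)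
    then have "card N \<le> card (\<Union>v\<in>{m - k..m + k}. {P. P \<subseteq> I \<and> card P = v})"
      using assms by (intro card_mono) auto
    also have "\<dots> \<le> (\<Sum>v\<in>{m - k..m + k}. card {P. P \<subseteq> I \<and> card P = v})"
      by (rule card_UN_le) simp
    also have "\<dots> \<le> (\<Sum>v\<in>{m - k..m + k}. 2 * m choose m)"
      using n_subsets[OF assms(1)] assms(2) binomial_maximum[of "2 * m"] by (intro sum_mono) simp
    also have "\<dots> \<le> (2 * k + 1) * (2 * m choose m)"
      by (simp del: mult_Suc)
    finally show ?thesis .
  qed
  moreover have "Pow I = U \<union> (L \<union> N)" by (auto simp: U_def L_def N_def)
  then have "2 ^ (2 * m) \<le> card U + (card L + card N)"
    using card_Pow[OF assms(1)] assms(2) card_Un_le[of U "L \<union> N"] card_Un_le[of L N] by simp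
  ultimately show ?thesis using \<open>card L = card U\<close> by (simp add: U_def)
qed

text \<open>The undecided band has a width fixed by \<open>k\<close>, while the share of each size
  tends to 0; so nearly half of all subsets are clear majorities once the even number
  \<open>d\<close> is large.\<close>

lemma majority_proportion:
  fixes eps :: real
  assumes "eps > 0"
  obtains d where "d \<ge> k" "d > 0"
    "2 * real (card {P \<in> Pow {1..int d}. d + k < 2 * card P}) \<ge> (1 - eps) * 2 ^ d"
proof -
  have "(\<lambda>m. (2 * real k + 1) * (real (2 * m choose m) / 4 ^ m)) \<longlonglongrightarrow> 0"
    using tendsto_mult_left[OF central_binomial_ratio_tendsto_0] by simp
  then have ev: "\<forall>\<^sub>F m in sequentially. (2 * real k + 1) * (real (2 * m choose m) / 4 ^ m) < eps"
    using assms by (rule order_tendstoD)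
  then obtain m where m: "m \<ge> k + 1" "(2 * real k + 1) * (real (2 * m choose m) / 4 ^ m) < eps"
    using eventually_happens[OF eventually_conj[OF eventually_ge_at_top[of "k + 1"] ev]] by auto
  have "(2 * real k + 1) * real (2 * m choose m) \<le> eps * 2 ^ (2 * m)"
  proof -
    have "(2 :: real) ^ (2 * m) = 4 ^ m" by (simp add: power_mult)
    then show ?thesis using m(2) by (simp add: pos_divide_less_eq)
  qed
  moreover have "real (2 ^ (2 * m)) \<le> real (2 * card {P \<in> Pow {1..int (2 * m)}. 2 * m + k < 2 * card P} + (2 * k + 1) * (2 * m choose m))"
    by (subst of_nat_le_iff, rule card_majority_subsets) auto
  ultimately have "2 * real (card {P \<in> Pow {1..int (2 * m)}. 2 * m + k < 2 * card P}) \<ge> (1 - eps) * 2 ^ (2 * m)"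
    by (simp add: algebra_simps)
  then show ?thesis using m(1) by (intro that[of "2 * m"]) auto
qed

section \<open>Rotations by almost half turns\<close>

text \<open>The fractions \<open>b j / (2 * e j)\<close> converge fast to an angle whose multiple by \<open>e j\<close> is nearly an integer
or a half-integer, as prescribed by \<open>p j\<close>.\<close>

lemma simultaneous_parity:
  fixes e :: "nat \<Rightarrow> int"
  assumes "K \<ge> 1" "e 0 \<ge> 1" and growth: "\<And>j. e (Suc j) \<ge> 4 * K * e j"
  obtains b :: "nat \<Rightarrow> int" where "\<And>j. odd (b j) \<longleftrightarrow> p j" "\<bar>b 0\<bar> \<le> 1"
    "\<And>i j. i \<le> j \<Longrightarrow> 2 * K * \<bar>e i * b j - b i * e j\<bar> \<le> e j"
proof -
  have pos: "e j \<ge> 1" for j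
  proof (induction j)
    case (Suc j)
    then have "1 * 1 \<le> 4 * K * e j" using \<open>K \<ge> 1\<close> by (intro mult_mono) auto
    then show ?case using growth[of j] by simp
  qed (use assms in simp)
  \<comment> \<open>\<open>b (Suc j)\<close> is whichever of the floor of
    \<open>e (Suc j) * b j / e j\<close> and its successor has the prescribed parity; the fraction
    \<open>b j / e j\<close> thus moves by at most \<open>1 / e (Suc j)\<close>.\<close>
  define b where "b = rec_nat (of_bool (p 0))
    (\<lambda>j x. let z = (e (Suc j) * x) div e j in if odd z = p (Suc j) then z else z + 1)"
  have b0: "b 0 = of_bool (p 0)" by (simp add: b_def)
  have bS: "b (Suc j) = (let z = (e (Suc j) * b j) div e j in if odd z = p (Suc j) then z else z + 1)" for j
    by (simp add: b_def)
  have parity: "odd (b j) \<longleftrightarrow> p j" for j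
    by (cases j) (auto simp: b0 bS Let_def)
  have step: "\<bar>e j * b (Suc j) - b j * e (Suc j)\<bar> \<le> e j" for j
  proof -
    define z where "z = (e (Suc j) * b j) div e j"
    define r where "r = (e (Suc j) * b j) mod e j"
    have "e (Suc j) * b j = e j * z + r" by (simp add: z_def r_def)
    moreover have "0 \<le> r" "r < e j" using pos[of j] by (simp_all add: r_def)
    moreover have "b (Suc j) = z \<or> b (Suc j) = z + 1" by (auto simp: bS z_def Let_def)
    ultimately show ?thesis by (auto simp: algebra_simps)
  qed
  \<comment> \<open>With \<open>j = i + l\<close>, division by \<open>e i * e j\<close> turns the
    bound into \<open>2 * K * \<bar>b j / e j - b i / e i\<bar> \<le> 1 / e i - 1 / e j\<close>,
    which telescopes; one step needs \<open>(2 * K + 1) * e j \<le> e (Suc j)\<close>.\<close>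
  have "2 * K * \<bar>e i * b (i + l) - b i * e (i + l)\<bar> \<le> e (i + l) - e i" for i l
  proof (induction l)
    case (Suc l)
    let ?j = "i + l"
    have e: "e ?j * (e i * b (Suc ?j) - b i * e (Suc ?j)) =
        e i * (e ?j * b (Suc ?j) - b ?j * e (Suc ?j)) + e (Suc ?j) * (e i * b ?j - b i * e ?j)"
      by (simp add: algebra_simps)
    have "e ?j * \<bar>e i * b (Suc ?j) - b i * e (Suc ?j)\<bar> = \<bar>e ?j * (e i * b (Suc ?j) - b i * e (Suc ?j))\<bar>"
      using pos[of ?j] by (simp add: abs_mult)
    also have "\<dots> \<le> e i * \<bar>e ?j * b (Suc ?j) - b ?j * e (Suc ?j)\<bar> + e (Suc ?j) * \<bar>e i * b ?j - b i * e ?j\<bar>"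
      unfolding e using pos[of i] pos[of "Suc ?j"] by (intro order_trans[OF abs_triangle_ineq]) (simp add: abs_mult)
    also have "\<dots> \<le> e i * e ?j + e (Suc ?j) * \<bar>e i * b ?j - b i * e ?j\<bar>"
      using step[of ?j] pos[of i] by simp
    finally have "2 * K * (e ?j * \<bar>e i * b (Suc ?j) - b i * e (Suc ?j)\<bar>) \<le>
        2 * K * (e i * e ?j + e (Suc ?j) * \<bar>e i * b ?j - b i * e ?j\<bar>)"
      using \<open>K \<ge> 1\<close> by (intro mult_left_mono) auto
    also have "\<dots> = 2 * K * (e i * e ?j) + e (Suc ?j) * (2 * K * \<bar>e i * b ?j - b i * e ?j\<bar>)"
      by (simp add: algebra_simps)
    also have "\<dots> \<le> 2 * K * (e i * e ?j) + e (Suc ?j) * (e ?j - e i)"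
      using Suc pos[of "Suc ?j"] by (intro add_left_mono mult_left_mono) auto
    also have "\<dots> \<le> e ?j * (e (Suc ?j) - e i)"
    proof -
      have "1 * e ?j \<le> K * e ?j" using pos[of ?j] \<open>K \<ge> 1\<close> by (intro mult_right_mono) auto
      moreover have "4 * (K * e ?j) \<le> e (Suc ?j)" using growth[of ?j] by (simp only: mult.assoc)
      ultimately have "2 * K * e ?j + e ?j \<le> e (Suc ?j)"
        using pos[of ?j] unfolding mult.assoc by linarith
      then have "e i * (2 * K * e ?j + e ?j) \<le> e i * e (Suc ?j)" using pos[of i] by (intro mult_left_mono) auto
      then show ?thesis by (simp add: algebra_simps)
    qed
    finally have "e ?j * (2 * K * \<bar>e i * b (Suc ?j) - b i * e (Suc ?j)\<bar>) \<le> e ?j * (e (Suc ?j) - e i)"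
      by (simp add: algebra_simps)
    then show ?case using pos[of ?j] by simp
  qed (simp add: mult.commute)
  then have "2 * K * \<bar>e i * b j - b i * e j\<bar> \<le> e j" if "i \<le> j" for i j
  proof -
    have "2 * K * \<bar>e i * b (i + (j - i)) - b i * e (i + (j - i))\<bar> \<le> e (i + (j - i)) - e i" by fact
    then show ?thesis using that pos[of i] by simp
  qed
  moreover have "\<bar>b 0\<bar> \<le> 1" by (simp add: b0)
  ultimately show ?thesis using that parity by blast
qed

text \<open>Take \<open>a = b J\<close> on the circle of length \<open>2 * e J\<close>: there
  \<open>e i * b J\<close> is close to \<open>b i * e J\<close>, a half turn or no turn according to
  the parity of \<open>b i\<close>. As \<open>\<bar>b 0\<bar> \<le> 1\<close>, the angle is of order
  \<open>1 / e 0\<close>, so multiples up to \<open>M\<close> stay near 0.\<close>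

lemma simultaneous_half_turns:
  fixes e :: "nat \<Rightarrow> int" and p :: "nat \<Rightarrow> bool"
  assumes "K \<ge> 1" "e 0 \<ge> 1" and growth: "\<And>j. e (Suc j) \<ge> 4 * K * e j" and "M \<ge> 0" "2 * K * M \<le> e 0"
  obtains a :: int where
    "\<And>i j. i \<le> J \<Longrightarrow> j \<le> J \<Longrightarrow> p i \<noteq> p j \<Longrightarrow> \<exists>m. odd m \<and> \<bar>(e i - e j) * a - m * e J\<bar> \<le> e J div K"
    "\<And>s. \<bar>s\<bar> \<le> M \<Longrightarrow> \<bar>s * a\<bar> \<le> e J div K"
proof -
  obtain b :: "nat \<Rightarrow> int" where b: "\<And>j. odd (b j) \<longleftrightarrow> p j" "\<bar>b 0\<bar> \<le> 1"
    "\<And>i j. i \<le> j \<Longrightarrow> 2 * K * \<bar>e i * b j - b i * e j\<bar> \<le> e j"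
    using simultaneous_parity[OF assms(1-3), of p] by blast
  have div: "x \<le> e J div K" if "K * x \<le> e J" for x
  proof -
    have "(K * x) div K \<le> e J div K" using that \<open>K \<ge> 1\<close> by (intro zdiv_mono1) auto
    then show ?thesis using \<open>K \<ge> 1\<close> by simp
  qed
  show ?thesis
  proof (rule that[of "b J"])
    fix i j assume ij: "i \<le> J" "j \<le> J" "p i \<noteq> p j"
    let ?x = "e i * b J - b i * e J" and ?y = "e j * b J - b j * e J"
    have "(e i - e j) * b J - (b i - b j) * e J = ?x - ?y" by (simp add: algebra_simps)
    moreover have "K * \<bar>?x - ?y\<bar> \<le> K * (\<bar>?x\<bar> + \<bar>?y\<bar>)" using \<open>K \<ge> 1\<close> by (intro mult_left_mono) auto
    then have "K * \<bar>?x - ?y\<bar> \<le> e J" using b(3)[OF ij(1)] b(3)[OF ij(2)] by (simp add: distrib_left)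
    moreover have "odd (b i - b j)" using ij(3) b(1)[of i] b(1)[of j] by (cases "p i") simp_all
    ultimately show "\<exists>m. odd m \<and> \<bar>(e i - e j) * b J - m * e J\<bar> \<le> e J div K"
      using div by (metis (no_types, lifting))
  next
    fix s :: int assume s: "\<bar>s\<bar> \<le> M"
    have eJ: "e J \<ge> 0" using b(3)[of J J] by simp
    have "e 0 * \<bar>b J\<bar> \<le> \<bar>e 0 * b J - b 0 * e J\<bar> + \<bar>b 0\<bar> * e J"
      using assms(2) eJ abs_triangle_ineq[of "e 0 * b J - b 0 * e J" "b 0 * e J"] by (simp add: abs_mult)
    also have "\<dots> \<le> \<bar>e 0 * b J - b 0 * e J\<bar> + e J"
      using b(2) eJ mult_right_mono[of "\<bar>b 0\<bar>" 1 "e J"] by simp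
    finally have "2 * K * (e 0 * \<bar>b J\<bar>) \<le> 2 * K * (\<bar>e 0 * b J - b 0 * e J\<bar> + e J)"
      using \<open>K \<ge> 1\<close> by (intro mult_left_mono) auto
    then have 1: "2 * K * (e 0 * \<bar>b J\<bar>) \<le> (2 * K + 1) * e J"
      using b(3)[of 0 J] by (simp add: algebra_simps)
    have "2 * e 0 * (K * \<bar>s * b J\<bar>) = \<bar>s\<bar> * (2 * K * (e 0 * \<bar>b J\<bar>))" by (simp add: abs_mult algebra_simps)
    also have "\<dots> \<le> M * ((2 * K + 1) * e J)"
      by (rule mult_mono[OF s 1 \<open>M \<ge> 0\<close>]) (use \<open>K \<ge> 1\<close> assms(2) in simp)
    also have "\<dots> \<le> 2 * e 0 * e J"
    proof -
      have "M \<le> K * M" using \<open>K \<ge> 1\<close> \<open>M \<ge> 0\<close> by (simp add: mult_le_cancel_right1)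
      then have "M * (2 * K + 1) \<le> 2 * e 0" using assms(5) \<open>M \<ge> 0\<close> by (simp add: algebra_simps)
      then have "M * (2 * K + 1) * e J \<le> 2 * e 0 * e J" using eJ by (rule mult_right_mono)
      then show ?thesis by (simp add: algebra_simps)
    qed
    finally show "\<bar>s * b J\<bar> \<le> e J div K" using assms(2) by (intro div) simp
  qed
qed

section \<open>Merging a periodic set with its translate\<close>

lemma card_periodic_multiple:
  assumes "Q > 0" "periodic Q A"
  shows "card (A \<inter> {0..<Q * int m}) = m * card (A \<inter> {0..<Q})"
proof (induction m)
  case (Suc m)
  have "A \<inter> {0..<Q * int (Suc m)} = (A \<inter> {0..<Q * int m}) \<union> (\<lambda>t. t + Q * int m) ` (A \<inter> {0..<Q})"
  proof (intro equalityI subsetI)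
    fix z assume z: "z \<in> A \<inter> {0..<Q * int (Suc m)}"
    show "z \<in> (A \<inter> {0..<Q * int m}) \<union> (\<lambda>t. t + Q * int m) ` (A \<inter> {0..<Q})"
    proof (cases "z < Q * int m")
      case False
      moreover have "z - Q * int m \<in> A" using periodic_dvd[OF assms(2), of "Q * int m" "z - Q * int m"] z by simp
      ultimately have "z - Q * int m \<in> A \<inter> {0..<Q}" using z by (simp add: algebra_simps)
      then show ?thesis by (intro UnI2 image_eqI[of _ _ "z - Q * int m"]) auto
    qed (use z in auto)
  next
    fix z assume "z \<in> (A \<inter> {0..<Q * int m}) \<union> (\<lambda>t. t + Q * int m) ` (A \<inter> {0..<Q})"
    then show "z \<in> A \<inter> {0..<Q * int (Suc m)}"
      using assms periodic_dvd[OF assms(2), of "Q * int m"] by (auto simp: algebra_simps)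
  qed
  moreover have "card (\<dots>) = card (A \<inter> {0..<Q * int m}) + card ((\<lambda>t. t + Q * int m) ` (A \<inter> {0..<Q}))"
    by (rule card_Un_disjoint) auto
  moreover have "card ((\<lambda>t. t + Q * int m) ` (A \<inter> {0..<Q})) = card (A \<inter> {0..<Q})"
    by (rule card_image) (auto simp: inj_on_def)
  ultimately show ?case using Suc by simp
qed simp

definition avoids :: "int set \<Rightarrow> int \<Rightarrow> bool" where
  "avoids A s \<longleftrightarrow> (\<forall>n\<in>A. n - s \<notin> A)"

text \<open>The orbit of the start point \<open>t\<close> on a torus of \<open>d\<close> circles of
  length \<open>2 * R\<close>, rotated by \<open>a\<close>. Coordinates that fall into the margins
  count for neither phase.\<close>

definition phase_set :: "int \<Rightarrow> int \<Rightarrow> nat \<Rightarrow> (int \<Rightarrow> int) \<Rightarrow> (int \<Rightarrow> int) \<Rightarrow> bool \<Rightarrow> int \<Rightarrow> int set" where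
  "phase_set R D d a t p n = {i \<in> {1..int d}. in_phase R D p (t i + n * a i)}"

text \<open>Nearly every \<open>n\<close> has a majority of one phase. Using \<open>A\<close> where one phase prevails and its
disjoint translate \<open>A + c\<close> where the other prevails costs almost no density, whereas an intersection
with a single phase would halve it.\<close>

definition majority_merge ::
  "int \<Rightarrow> int \<Rightarrow> nat \<Rightarrow> nat \<Rightarrow> (int \<Rightarrow> int) \<Rightarrow> int set \<Rightarrow> int \<Rightarrow> (int \<Rightarrow> int) \<Rightarrow> int set" where
  "majority_merge R D d k a A c t =
    {n. n \<in> A \<and> d + k < 2 * card (phase_set R D d a t True n)} \<union>
    {n. n - c \<in> A \<and> d + k < 2 * card (phase_set R D d a t False n)}"

lemma phase_set_periodic:
  assumes "2 * R dvd w" shows "phase_set R D d a t p (n + w) = phase_set R D d a t p n"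
proof -
  have "in_phase R D p (t i + (n + w) * a i) \<longleftrightarrow> in_phase R D p (t i + n * a i)" for i
    using periodic_dvd[OF periodic_in_phase[of R D p], of "w * a i" "t i + n * a i"] assms
    by (simp add: algebra_simps)
  then show ?thesis by (simp add: phase_set_def)
qed

lemma periodic_majority_merge:
  assumes "periodic Q A" shows "periodic (Q * (2 * R)) (majority_merge R D d k a A c t)"
proof -
  have "z + Q * (2 * R) \<in> A \<longleftrightarrow> z \<in> A" for z using periodic_dvd[OF assms] by simp
  from this[of "z - c" for z] this
  show ?thesis unfolding periodic_def majority_merge_def
    by (simp add: phase_set_periodic diff_add_eq)
qed

lemma finite_phase_set [simp]: "finite (phase_set R D d a t p n)"
  by (rule finite_subset[of _ "{1..int d}"]) (auto simp: phase_set_def)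

text \<open>Two sets of more than \<open>(d + k) / 2\<close> coordinates share more than
  \<open>k\<close> of them, and \<open>X\<close> misses at most \<open>k\<close>.\<close>

lemma phase_sets_intersect:
  assumes "d + k < 2 * card (phase_set R D d a t p n)" "d + k < 2 * card (phase_set R D d a t p' n')"
    and "X \<subseteq> {1..int d}" "d \<le> card X + k"
  shows "\<exists>i\<in>X. i \<in> phase_set R D d a t p n \<and> i \<in> phase_set R D d a t p' n'"
proof (rule ccontr)
  assume no: "\<not> ?thesis"
  let ?P = "phase_set R D d a t p n" and ?P' = "phase_set R D d a t p' n'"
  have fin: "finite X" using assms(3) by (rule finite_subset) simp
  have "card ?P + card ?P' = card (?P \<union> ?P') + card (?P \<inter> ?P')" by (rule card_Un_Int) auto
  moreover have "card (?P \<union> ?P') \<le> card {1..int d}" by (rule card_mono) (auto simp: phase_set_def)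
  moreover have "card (?P \<inter> ?P') \<le> card ({1..int d} - X)"
    using no by (intro card_mono) (auto simp: phase_set_def)
  moreover have "card ({1..int d} - X) = d - card X" using assms(3) fin by (simp add: card_Diff_subset)
  moreover have "card X \<le> d" using card_mono[OF _ assms(3)] by simp
  ultimately show False using assms by simp
qed

text \<open>A half turn on \<open>X\<close> rules out equal majorities at \<open>n\<close> and
  \<open>n - s\<close>, so one of them comes from \<open>A\<close> and the other from
  \<open>A + c\<close>. Since the period \<open>Q\<close> divides \<open>s\<close>, this would put
  one point into both.\<close>

lemma majority_merge_avoids_half_turn:
  assumes "R > 0" "periodic Q A" "Q dvd s" "avoids A c" "X \<subseteq> {1..int d}" "d < card X + k"
    and turn: "\<And>i. i \<in> X \<Longrightarrow> \<exists>m. odd m \<and> \<bar>s * a i - m * R\<bar> \<le> D"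
  shows "avoids (majority_merge R D d k a A c t) s"
  unfolding avoids_def
proof (intro ballI notI)
  fix n assume n: "n \<in> majority_merge R D d k a A c t" "n - s \<in> majority_merge R D d k a A c t"
  have no: False
    if large: "d + k < 2 * card (phase_set R D d a t p n)"
      "d + k < 2 * card (phase_set R D d a t p (n - s))" for p
  proof -
    obtain i where i: "i \<in> X" "i \<in> phase_set R D d a t p n" "i \<in> phase_set R D d a t p (n - s)"
      using phase_sets_intersect[OF large assms(5)] assms(6) by auto
    obtain m where m: "odd m" "\<bar>s * a i - m * R\<bar> \<le> D" using turn[OF i(1)] by blast
    have eq: "t i + n * a i = (t i + (n - s) * a i) + s * a i" by (simp add: algebra_simps)
    have "in_phase R D p (t i + n * a i)" "in_phase R D p (t i + (n - s) * a i)"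
      using i by (simp_all add: phase_set_def)
    then show False using in_phase_shift[OF assms(1) _ _ m(2)] m(1) unfolding eq by blast
  qed
  have shift: "z - s \<in> A \<longleftrightarrow> z \<in> A" for z
    using periodic_dvd[OF assms(2,3), of "z - s"] by simp
  have "n - c \<notin> A" if "n \<in> A" using assms(4) that by (simp add: avoids_def)
  moreover have "n - s - c \<in> A \<longleftrightarrow> n - c \<in> A" using shift[of "n - c"] by (simp add: algebra_simps)
  ultimately show False using n no shift[of n] unfolding majority_merge_def by auto
qed

text \<open>No coordinate can change its phase under a shift by at most \<open>D\<close>, so
  \<open>n\<close> and \<open>n - s\<close> come both from \<open>A\<close> or both from
  \<open>A + c\<close>, which has the same differences as \<open>A\<close>.\<close>

lemma majority_merge_avoids_small:
  assumes "R > 0" "avoids A s" and small: "\<And>i. i \<in> {1..int d} \<Longrightarrow> \<bar>s * a i\<bar> \<le> D"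
  shows "avoids (majority_merge R D d k a A c t) s"
  unfolding avoids_def
proof (intro ballI notI)
  fix n assume n: "n \<in> majority_merge R D d k a A c t" "n - s \<in> majority_merge R D d k a A c t"
  have no: False
    if large: "d + k < 2 * card (phase_set R D d a t p n)"
      "d + k < 2 * card (phase_set R D d a t (\<not> p) (n - s))" for p
  proof -
    obtain i where i: "i \<in> {1..int d}" "i \<in> phase_set R D d a t p n" "i \<in> phase_set R D d a t (\<not> p) (n - s)"
      using phase_sets_intersect[OF large order_refl] by auto
    have eq: "t i + n * a i = (t i + (n - s) * a i) + s * a i" by (simp add: algebra_simps)
    have "in_phase R D p (t i + n * a i)" "in_phase R D (\<not> p) (t i + (n - s) * a i)"
      using i by (simp_all add: phase_set_def)
    moreover have "\<bar>s * a i - 0 * R\<bar> \<le> D" using small[OF i(1)] by simp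
    ultimately show False using in_phase_shift[OF assms(1)] unfolding eq by (metis even_zero)
  qed
  have "n - s \<notin> A" if "n \<in> A" using assms(2) that by (simp add: avoids_def)
  moreover have "n - s - c \<notin> A" if "n - c \<in> A"
    using assms(2) that by (simp add: avoids_def diff_right_commute)
  ultimately show False using n no[of True] no[of False] unfolding majority_merge_def by auto
qed

section \<open>Density of merged sets\<close>

text \<open>For fixed \<open>n\<close> and \<open>P\<close>, the start points with phase
  \<open>p\<close> on \<open>P\<close> and the opposite phase off \<open>P\<close> form a box of
  \<open>(R - 2 * D) ^ d\<close> points; the boxes of different \<open>P\<close> are
  disjoint.\<close>

lemma card_majority_phase_ge:
  assumes "R > 0" "D \<ge> 0" "2 * D \<le> R"
  shows "card {P \<in> Pow {1..int d}. d + k < 2 * card P} * nat (R - 2 * D) ^ d \<le>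
    card {t \<in> {1..int d} \<rightarrow>\<^sub>E {0..<2 * R}. d + k < 2 * card (phase_set R D d a t p n)}"
proof -
  define I where "I = {1..int d}"
  define \<P> where "\<P> = {P \<in> Pow I. d + k < 2 * card P}"
  define X where "X P = (\<Pi>\<^sub>E i\<in>I. {x \<in> {0..<2 * R}. in_phase R D (i \<in> P \<longleftrightarrow> p) (x + n * a i)})" for P
  have fin: "finite I" "finite \<P>" by (simp_all add: I_def \<P>_def)
  have finX: "finite (X P)" for P     unfolding X_def by (rule finite_PiE[OF fin(1)], rule finite_subset[of _ "{0..<2 * R}"]) auto
  have cardX: "card (X P) = nat (R - 2 * D) ^ d" for P
    unfolding X_def card_PiE[OF fin(1)] using card_in_phase[OF assms] by (simp add: I_def)
  have phase: "phase_set R D d a t p n = P" if "t \<in> X P" "P \<in> \<P>" for t P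
  proof -
    have "in_phase R D p (t i + n * a i) \<longleftrightarrow> i \<in> P" if i: "i \<in> I" for i
    proof -
      have 1: "in_phase R D (i \<in> P \<longleftrightarrow> p) (t i + n * a i)"
        using \<open>t \<in> X P\<close> i by (auto simp: X_def PiE_iff)
      then show ?thesis
        using in_phase_shift[OF assms(1) 1, of p 0 0] assms(2) by auto
    qed
    then show ?thesis using that(2) by (auto simp: phase_set_def I_def \<P>_def)
  qed
  have "card (\<Union>P\<in>\<P>. X P) = (\<Sum>P\<in>\<P>. card (X P))"
  proof (rule card_UN_disjoint[OF fin(2)])
    show "\<forall>P\<in>\<P>. finite (X P)" using finX by simp
    show "\<forall>P\<in>\<P>. \<forall>Q\<in>\<P>. P \<noteq> Q \<longrightarrow> X P \<inter> X Q = {}" using phase by blast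
  qed
  also have "\<dots> = card \<P> * nat (R - 2 * D) ^ d" by (simp add: cardX)
  finally have "card \<P> * nat (R - 2 * D) ^ d = card (\<Union>P\<in>\<P>. X P)" ..
  also have "\<dots> \<le> card {t \<in> I \<rightarrow>\<^sub>E {0..<2 * R}. d + k < 2 * card (phase_set R D d a t p n)}"
  proof (rule card_mono)
    show "finite {t \<in> I \<rightarrow>\<^sub>E {0..<2 * R}. d + k < 2 * card (phase_set R D d a t p n)}"
      using fin by (intro finite_subset[OF _ finite_PiE[of I "\<lambda>_. {0..<2 * R}"]]) auto
    show "(\<Union>P\<in>\<P>. X P) \<subseteq> {t \<in> I \<rightarrow>\<^sub>E {0..<2 * R}. d + k < 2 * card (phase_set R D d a t p n)}"
    proof
      fix t assume "t \<in> (\<Union>P\<in>\<P>. X P)"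
      then obtain P where P: "P \<in> \<P>" "t \<in> X P" by blast
      then have "d + k < 2 * card (phase_set R D d a t p n)" using phase[OF P(2,1)] by (simp add: \<P>_def)
      moreover have "t \<in> I \<rightarrow>\<^sub>E {0..<2 * R}" using P(2) by (auto simp: X_def PiE_iff)
      ultimately show "t \<in> {t \<in> I \<rightarrow>\<^sub>E {0..<2 * R}. d + k < 2 * card (phase_set R D d a t p n)}" by simp
    qed
  qed
  finally show ?thesis by (simp add: I_def \<P>_def)
qed

text \<open>Average over all \<open>(2 * R) ^ d\<close> start points. As \<open>A\<close> and
  \<open>A + c\<close> are disjoint, a window contains twice as many candidates \<open>n\<close> as
  points of \<open>A\<close>, which makes up for each majority having a share of only about one
  half.\<close>

lemma dense_majority_merge:
  fixes d k :: nat
  assumes "R > 0" "D \<ge> 0" "2 * D \<le> R" and A: "Q > 0" "periodic Q A" "avoids A c"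
  defines "W \<equiv> Q * (2 * R)" and "B \<equiv> card {P \<in> Pow {1..int d}. d + k < 2 * card P}"
  obtains t where "2 * card (A \<inter> {0..<W}) * (B * nat (R - 2 * D) ^ d) \<le>
    nat (2 * R) ^ d * card (majority_merge R D d k a A c t \<inter> {0..<W})"
proof (rule ccontr)
  assume no: "\<not> thesis"
  define T where "T = ({1..int d} \<rightarrow>\<^sub>E {0..<2 * R})"
  let ?m = "majority_merge R D d k a A c"
  let ?q = "B * nat (R - 2 * D) ^ d"
  have finT: "finite T" unfolding T_def by (intro finite_PiE) auto
  have cardT: "card T = nat (2 * R) ^ d" by (simp add: T_def card_PiE)
  then have T: "card T > 0" using assms(1) by simp
  have "W > 0" using assms by simp

  have "card {n \<in> {0..<W}. n - c \<in> A} = card (A \<inter> {0..<W})"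
    using card_periodic_shift[OF \<open>W > 0\<close> periodic_mono[OF A(2)], of "- c"] by (simp add: W_def)
  moreover have "{n \<in> {0..<W}. n \<in> A} \<inter> {n \<in> {0..<W}. n - c \<in> A} = {}"
    using A(3) by (auto simp: avoids_def)
  ultimately have "2 * card (A \<inter> {0..<W}) = card ({n \<in> {0..<W}. n \<in> A} \<union> {n \<in> {0..<W}. n - c \<in> A})"
  proof -
    have "finite {n \<in> {0..<W}. n \<in> A}" "finite {n \<in> {0..<W}. n - c \<in> A}"
      by (rule finite_subset[of _ "{0..<W}"]; auto)+
    moreover have "{n \<in> {0..<W}. n \<in> A} = A \<inter> {0..<W}" by auto
    ultimately show ?thesis
      using \<open>{n \<in> {0..<W}. n \<in> A} \<inter> {n \<in> {0..<W}. n - c \<in> A} = {}\<close>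
        \<open>card {n \<in> {0..<W}. n - c \<in> A} = card (A \<inter> {0..<W})\<close> by (simp add: card_Un_disjoint)
  qed
  also have "{n \<in> {0..<W}. n \<in> A} \<union> {n \<in> {0..<W}. n - c \<in> A} = {n \<in> {0..<W}. n \<in> A \<or> n - c \<in> A}"
    by auto
  finally have "2 * card (A \<inter> {0..<W}) * ?q = (\<Sum>n\<in>{n \<in> {0..<W}. n \<in> A \<or> n - c \<in> A}. ?q)" by simp
  also have "\<dots> \<le> (\<Sum>n\<in>{n \<in> {0..<W}. n \<in> A \<or> n - c \<in> A}. card {t \<in> T. n \<in> ?m t})"
  proof (rule sum_mono)
    fix n assume n: "n \<in> {n \<in> {0..<W}. n \<in> A \<or> n - c \<in> A}"
    define p where "p \<longleftrightarrow> n \<in> A"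
    have "?q \<le> card {t \<in> T. d + k < 2 * card (phase_set R D d a t p n)}"
      unfolding B_def T_def by (rule card_majority_phase_ge[OF assms(1-3)])
    also have "\<dots> \<le> card {t \<in> T. n \<in> ?m t}"
    proof (rule card_mono)
      have "d + k < 2 * card (phase_set R D d a t p n) \<Longrightarrow> n \<in> ?m t" for t
        using n by (cases "n \<in> A") (simp_all add: majority_merge_def p_def)
      then show "{t \<in> T. d + k < 2 * card (phase_set R D d a t p n)} \<subseteq> {t \<in> T. n \<in> ?m t}" by blast
    qed (use finT in simp)
    finally show "?q \<le> card {t \<in> T. n \<in> ?m t}" .
  qed
  also have "\<dots> \<le> (\<Sum>n\<in>{0..<W}. card {t \<in> T. n \<in> ?m t})" by (rule sum_mono2) auto
  also have "\<dots> = (\<Sum>t\<in>T. card {n \<in> {0..<W}. n \<in> ?m t})"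
    using sum.swap_restrict[of "{0..<W}" T "\<lambda>_ _. 1::nat" "\<lambda>n t. n \<in> ?m t"] finT by simp
  finally have "2 * card (A \<inter> {0..<W}) * ?q \<le> (\<Sum>t\<in>T. card (?m t \<inter> {0..<W}))"
    by (simp add: Int_def conj_commute)
  then have "card T * (2 * card (A \<inter> {0..<W}) * ?q) \<le> (\<Sum>t\<in>T. card T * card (?m t \<inter> {0..<W}))"
    by (simp flip: sum_distrib_left)
  also have "\<dots> < (\<Sum>t\<in>T. 2 * card (A \<inter> {0..<W}) * ?q)"
  proof (rule sum_strict_mono[OF finT])
    show "T \<noteq> {}" using T by auto
    show "card T * card (?m t \<inter> {0..<W}) < 2 * card (A \<inter> {0..<W}) * ?q" for t
      using no that[of t] unfolding cardT by (metis not_le_imp_less)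
  qed
  finally show False by simp
qed

section \<open>Fast growing elements in one residue class\<close>

lemma lacunary_sequence:
  fixes E :: "int set"
  assumes "\<And>N. \<exists>e\<in>E. e > N"
  obtains e :: "nat \<Rightarrow> int" where "range e \<subseteq> E" "e 0 > N" "\<And>j. e (Suc j) > K * e j"
proof -
  define e where "e = rec_nat (SOME x. x \<in> E \<and> x > N) (\<lambda>_ y. SOME x. x \<in> E \<and> x > K * y)"
  have ex: "\<exists>x. x \<in> E \<and> x > z" for z using assms by blast
  have 0: "e 0 \<in> E \<and> e 0 > N" using someI_ex[OF ex[of N]] by (simp add: e_def)
  have S: "e (Suc j) \<in> E \<and> e (Suc j) > K * e j" for j
    using someI_ex[OF ex[of "K * e j"]] by (simp add: e_def)
  have "e j \<in> E" for j using 0 S by (cases j) auto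
  then show ?thesis using that[of e] 0 S by blast
qed

text \<open>Pigeonhole on residues. It makes all new differences multiples of the period of the
  current set, as the half-turn argument demands.\<close>

lemma unbounded_residue_class:
  fixes E :: "int set"
  assumes "infinite (E \<inter> {0..})" "Q > 0"
  obtains E' where "E' \<subseteq> E" "\<And>N. \<exists>e\<in>E'. e > N" "\<And>x y. x \<in> E' \<Longrightarrow> y \<in> E' \<Longrightarrow> Q dvd x - y"
proof -
  have "finite ((\<lambda>x. x mod Q) ` (E \<inter> {0..}))"
    by (rule finite_subset[of _ "{0..<Q}"]) (use assms(2) in auto)
  then obtain a where a: "infinite {x \<in> E \<inter> {0..}. x mod Q = a mod Q}"
    using pigeonhole_infinite[OF assms(1)] by blast
  show ?thesis
  proof (rule that[of "{x \<in> E \<inter> {0..}. x mod Q = a mod Q}"])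
    fix N
    show "\<exists>e\<in>{x \<in> E \<inter> {0..}. x mod Q = a mod Q}. e > N"
    proof (rule ccontr)
      assume "\<not> ?thesis"
      then have "{x \<in> E \<inter> {0..}. x mod Q = a mod Q} \<subseteq> {0..N}" by force
      then show False using a finite_subset by blast
    qed
    show "Q dvd x - y" if "x \<in> {x \<in> E \<inter> {0..}. x mod Q = a mod Q}" "y \<in> {x \<in> E \<inter> {0..}. x mod Q = a mod Q}" for x y
      using that by (simp flip: mod_eq_dvd_iff)
  qed auto
qed

text \<open>Keeps the new differences above \<open>M\<close>, too long to occur inside the blocks
  already fixed.\<close>

lemma lacunary_difference_gt:
  fixes e :: "nat \<Rightarrow> int"
  assumes "e 0 > M" "M \<ge> 0" "\<And>j. e (Suc j) \<ge> 2 * e j" "i \<noteq> j"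
  shows "\<bar>e i - e j\<bar> > M"
proof -
  have pos: "e j > M" for j
  proof (induction j)
    case (Suc j) then show ?case using assms(2) assms(3)[of j] by simp
  qed (rule assms(1))
  have "e (Suc i + l) \<ge> 2 * e i" for i l
  proof (induction l)
    case (Suc l) then show ?case using assms(2) assms(3)[of "Suc i + l"] pos[of "Suc i + l"] by simp
  qed (use assms(3) in simp)
  then have "e j - e i > M" if "i < j" for i j
  proof -
    have "e (Suc i + (j - Suc i)) \<ge> 2 * e i" by fact
    then show ?thesis using that pos[of i] by simp
  qed
  from this[of i j] this[of j i] show ?thesis using \<open>i \<noteq> j\<close> by (cases "i < j") auto
qed

text \<open>Two factors \<open>1 - eps / 2\<close>: one for the undecided majorities, through
  \<open>B\<close>, and one for the margins, where Bernoulli bounds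
  \<open>(1 - 2 * D / R) ^ d\<close> from below by \<open>1 - 2 * d * D / R\<close>.\<close>

lemma density_loss:
  fixes R D K :: real
  assumes "R > 0" "D \<ge> 0" "2 * D \<le> R" "4 * real d * D \<le> eps * R" "0 < eps" "eps \<le> 1"
    and B: "(1 - eps / 2) * 2 ^ d \<le> 2 * B" and "\<alpha> \<ge> 0"
    and le: "2 * \<alpha> * (B * (R - 2 * D) ^ d) \<le> (2 * R) ^ d * \<beta>"
  shows "(1 - eps) * \<alpha> \<le> \<beta>"
proof -
  have "(1 - eps / 2) \<le> 1 + real d * (- (2 * D / R))"
    using assms(1,4) by (simp add: field_simps)
  also have "\<dots> \<le> (1 + - (2 * D / R)) ^ d"
    using assms(1,3) by (intro Bernoulli_inequality) (simp add: field_simps)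
  finally have "(1 - eps / 2) * R ^ d \<le> (1 + - (2 * D / R)) ^ d * R ^ d"
    using assms(1) by (intro mult_right_mono) auto
  also have "\<dots> = (R - 2 * D) ^ d"
    using assms(1) by (simp add: diff_divide_distrib left_diff_distrib flip: power_mult_distrib)
  finally have RD: "(1 - eps / 2) * R ^ d \<le> (R - 2 * D) ^ d" .
  have "(2 * R) ^ d * ((1 - eps) * \<alpha>) \<le> (2 * R) ^ d * ((1 - eps / 2) * (1 - eps / 2) * \<alpha>)"
    using assms(1,8) by (intro mult_left_mono mult_right_mono) (auto simp: algebra_simps)
  also have "\<dots> = \<alpha> * (((1 - eps / 2) * 2 ^ d) * ((1 - eps / 2) * R ^ d))"
    by (simp add: power_mult_distrib)
  also have "\<dots> \<le> \<alpha> * ((2 * B) * (R - 2 * D) ^ d)"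
  proof (rule mult_left_mono[OF mult_mono[OF B RD] \<open>\<alpha> \<ge> 0\<close>])
    have "0 \<le> (1 - eps / 2) * 2 ^ d" using assms(6) by simp
    then show "0 \<le> 2 * B" using B by linarith
    show "0 \<le> (1 - eps / 2) * R ^ d" using assms(1,6) by simp
  qed
  also have "\<dots> = 2 * \<alpha> * (B * (R - 2 * D) ^ d)" by simp
  also note le
  finally show ?thesis using assms(1) by simp
qed

text \<open>Recurrence for a bounded number of colours, a property that finite sets can
  have.\<close>

definition colour_recurrent :: "nat \<Rightarrow> int set \<Rightarrow> bool" where
  "colour_recurrent k S \<longleftrightarrow> (\<forall>f :: int \<Rightarrow> nat. (\<forall>x. f x < k) \<longrightarrow> (\<exists>x y. f x = f y \<and> x - y \<in> S))"

text \<open>The conclusion reproduces the hypotheses on \<open>A\<close>, so the step can be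
  repeated. The bound \<open>M\<close> separates the old differences, which stay avoided, from the
  new ones.\<close>

lemma recurrence_step:
  fixes E A :: "int set" and \<delta> \<delta>' :: real
  assumes E: "infinite (E \<inter> {0..})" and A: "Q > 0" "periodic Q A" "avoids A c"
    and dens: "\<delta> * Q \<le> card (A \<inter> {0..<Q})" "0 < \<delta>'" "\<delta>' < \<delta>" and "M \<ge> 0" "k \<ge> 1"
  obtains S A' Q' c' where "finite S" "S \<subseteq> difference_set E" "colour_recurrent k S"
    "\<And>s. s \<in> S \<Longrightarrow> \<bar>s\<bar> > M" "\<And>s. s \<in> S \<Longrightarrow> avoids A' s"
    "\<And>s. \<bar>s\<bar> \<le> M \<Longrightarrow> avoids A s \<Longrightarrow> avoids A' s"
    "Q' > 0" "periodic Q' A'" "avoids A' c'" "\<delta>' * Q' \<le> card (A' \<inter> {0..<Q'})"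
proof -
  define eps where "eps = 1 - \<delta>' / \<delta>"
  have eps: "0 < eps" "eps \<le> 1" "\<delta>' = (1 - eps) * \<delta>" using dens by (auto simp: eps_def field_simps)
  obtain d where d: "d \<ge> k" "d > 0"
    "2 * real (card {P \<in> Pow {1..int d}. d + k < 2 * card P}) \<ge> (1 - eps / 2) * 2 ^ d"
    using majority_proportion[of "eps / 2" k] eps(1) by auto
  define I where "I = {1..int d}"
  define B where "B = card {P \<in> Pow I. d + k < 2 * card P}"
  obtain E' where E': "E' \<subseteq> E" "\<And>N. \<exists>e\<in>E'. e > N" "\<And>x y. x \<in> E' \<Longrightarrow> y \<in> E' \<Longrightarrow> Q dvd x - y"
    using unbounded_residue_class[OF E A(1)] by blast
  \<comment> \<open>For \<open>D = R div K\<close> this gives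
    \<open>4 * d * D \<le> eps * R\<close>, as required by the estimate of the density loss, and
    \<open>2 * D \<le> R\<close>.\<close>
  define K where "K = max 2 \<lceil>4 * real d / eps\<rceil>"
  have K: "K \<ge> 2" "4 * real d / eps \<le> K" unfolding K_def by (simp_all, linarith)
  obtain e :: "nat \<Rightarrow> int" where e: "range e \<subseteq> E'" "e 0 > 2 * K * M" "\<And>j. e (Suc j) > 4 * K * e j"
    using lacunary_sequence[OF E'(2), where N = "2 * K * M" and K = "4 * K"] by blast
  have "M \<le> 2 * K * M" using K(1) \<open>M \<ge> 0\<close> by (simp add: mult_le_cancel_right1)
  then have e0: "e 0 > M" using e(2) by simp
  have pos: "e j > 0" for j
  proof (induction j)
    case (Suc j)
    then have "4 * K * e j > 0" using K(1) by simp
    then show ?case using e(3)[of j] by simp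
  qed (use e0 \<open>M \<ge> 0\<close> in simp)
  have growth: "e (Suc j) \<ge> 2 * e j" for j
  proof -
    have "2 * e j \<le> 4 * K * e j" using K(1) pos[of j] by (intro mult_right_mono) auto
    then show ?thesis using e(3)[of j] by simp
  qed
  \<comment> \<open>The subsets are numbered by \<open>h\<close>: the element of \<open>E\<close>
    attached to \<open>X\<close> is \<open>e (h X)\<close>, and \<open>J\<close> is the last
    index.\<close>
  have "finite (Pow I)" "card (Pow I) = 2 ^ d" by (simp_all add: I_def card_Pow)
  then obtain h :: "int set \<Rightarrow> nat" where h: "bij_betw h (Pow I) {0..<2 ^ d}"
    using ex_bij_betw_finite_nat[of "Pow I"] by auto
  define J where "J = (2::nat) ^ d - 1"
  have hJ: "h X \<le> J" if "X \<subseteq> I" for X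
  proof -
    have "h X \<in> {0..<2 ^ d}" using bij_betwE[OF h] that by blast
    then show ?thesis unfolding J_def by simp
  qed
  define g where "g = inv_into (Pow I) h"
  have g: "g (h X) = X" if "X \<subseteq> I" for X
    using h that by (simp add: g_def bij_betw_def inv_into_f_f)
  define R where "R = e J"
  define D where "D = R div K"
  have "R > 0" by (simp add: R_def pos)
  have D: "D \<ge> 0" "K * D \<le> R"
  proof -
    show "D \<ge> 0" using \<open>R > 0\<close> K(1) by (simp add: D_def pos_imp_zdiv_nonneg_iff)
    have "K * D + R mod K = R" by (simp add: D_def)
    then show "K * D \<le> R" using pos_mod_sign[of K R] K(1) by linarith
  qed
  have "2 * D \<le> K * D" using K(1) D(1) by (rule mult_right_mono)
  then have D2: "2 * D \<le> R" using D(2) by simp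
  \<comment> \<open>The parity prescribed at index \<open>i\<close> for coordinate \<open>x\<close>
    is membership of \<open>x\<close> in the \<open>i\<close>-th subset. Thus
    \<open>e (h X) - e (h Y)\<close> is nearly a half turn in every coordinate where
    \<open>X\<close> and \<open>Y\<close> differ.\<close>
  have "\<forall>x. \<exists>a. (\<forall>i j. i \<le> J \<longrightarrow> j \<le> J \<longrightarrow> (x \<in> g i) \<noteq> (x \<in> g j) \<longrightarrow>
        (\<exists>m. odd m \<and> \<bar>(e i - e j) * a - m * R\<bar> \<le> D)) \<and> (\<forall>s. \<bar>s\<bar> \<le> M \<longrightarrow> \<bar>s * a\<bar> \<le> D)"
  proof
    fix x
    have "K \<ge> 1" "e 0 \<ge> 1" "2 * K * M \<le> e 0" "\<And>j. e (Suc j) \<ge> 4 * K * e j"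
      using K(1) pos[of 0] e(2,3) by (simp_all add: less_imp_le)
    note * = simultaneous_half_turns[of K e M J "\<lambda>i. x \<in> g i", OF this(1,2,4) \<open>M \<ge> 0\<close> this(3)]
    show "\<exists>a. (\<forall>i j. i \<le> J \<longrightarrow> j \<le> J \<longrightarrow> (x \<in> g i) \<noteq> (x \<in> g j) \<longrightarrow>
        (\<exists>m. odd m \<and> \<bar>(e i - e j) * a - m * R\<bar> \<le> D)) \<and> (\<forall>s. \<bar>s\<bar> \<le> M \<longrightarrow> \<bar>s * a\<bar> \<le> D)"
      unfolding R_def D_def by (rule *) blast
  qed
  from choice[OF this] obtain a where "\<forall>x. (\<forall>i j. i \<le> J \<longrightarrow> j \<le> J \<longrightarrow> (x \<in> g i) \<noteq> (x \<in> g j) \<longrightarrow>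
        (\<exists>m. odd m \<and> \<bar>(e i - e j) * a x - m * R\<bar> \<le> D)) \<and> (\<forall>s. \<bar>s\<bar> \<le> M \<longrightarrow> \<bar>s * a x\<bar> \<le> D)"
    by blast
  then have a: "\<And>x i j. i \<le> J \<Longrightarrow> j \<le> J \<Longrightarrow> (x \<in> g i) \<noteq> (x \<in> g j) \<Longrightarrow>
        \<exists>m. odd m \<and> \<bar>(e i - e j) * a x - m * R\<bar> \<le> D" "\<And>x s. \<bar>s\<bar> \<le> M \<Longrightarrow> \<bar>s * a x\<bar> \<le> D"
    by blast+
  obtain t where t: "2 * card (A \<inter> {0..<Q * (2 * R)}) * (B * nat (R - 2 * D) ^ d) \<le>
    nat (2 * R) ^ d * card (majority_merge R D d k a A c t \<inter> {0..<Q * (2 * R)})"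
    using dense_majority_merge[OF \<open>R > 0\<close> D(1) D2 A, of d k a] unfolding B_def I_def by blast
  define A' where "A' = majority_merge R D d k a A c t"
  define S where "S = {e (h X) - e (h Y) | X Y. X \<subseteq> I \<and> Y \<subseteq> I \<and> d < card ((X - Y) \<union> (Y - X)) + k}"
  have S_cases: "\<exists>X Y. s = e (h X) - e (h Y) \<and> X \<subseteq> I \<and> Y \<subseteq> I \<and> d < card ((X - Y) \<union> (Y - X)) + k" if "s \<in> S" for s
    using that unfolding S_def by blast
  have rec: "colour_recurrent k S"
    unfolding colour_recurrent_def
  proof (intro allI impI)
    fix f :: "int \<Rightarrow> nat" assume "\<forall>x. f x < k"
    then have f: "f (e (h X)) < k" for X by blast
    obtain X Y where "X \<subseteq> I" "Y \<subseteq> I" "f (e (h X)) = f (e (h Y))" "d < card ((X - Y) \<union> (Y - X)) + k"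
      unfolding I_def
      by (rule same_colour_distant_subsets[OF d(1), where c = "\<lambda>X. f (e (h X))", OF f]) blast
    then show "\<exists>x y. f x = f y \<and> x - y \<in> S" unfolding S_def by blast
  qed
  have avoid: "avoids A' s" if s: "s \<in> S" for s
  proof -
    obtain X Y where XY: "s = e (h X) - e (h Y)" "X \<subseteq> I" "Y \<subseteq> I" "d < card ((X - Y) \<union> (Y - X)) + k"
      using S_cases[OF s] by blast
    have dvd: "Q dvd s" using E'(3) e(1) XY(1) by blast
    have sub: "(X - Y) \<union> (Y - X) \<subseteq> {1..int d}" using XY by (auto simp: I_def)
    have turn: "\<exists>m. odd m \<and> \<bar>s * a i - m * R\<bar> \<le> D" if "i \<in> (X - Y) \<union> (Y - X)" for i
      using a(1)[OF hJ[OF XY(2)] hJ[OF XY(3)], of i] that g XY(1-3) by auto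
    show ?thesis
      unfolding A'_def
      by (rule majority_merge_avoids_half_turn[OF \<open>R > 0\<close> A(2) dvd A(3) sub XY(4) turn])
  qed
  \<comment> \<open>The constant colouring shows that \<open>S\<close> is nonempty; any of its
    elements supplies the disjoint translate for the next stage.\<close>
  obtain c' where "c' \<in> S"     using rec[unfolded colour_recurrent_def, rule_format, of "\<lambda>_. 0"] \<open>k \<ge> 1\<close> by auto
  show ?thesis
  proof (rule that[of S A' "Q * (2 * R)" c'])
    have "S \<subseteq> (\<lambda>(X, Y). e (h X) - e (h Y)) ` (Pow I \<times> Pow I)" unfolding S_def by fast
    then show "finite S" by (rule finite_subset) (simp add: I_def)
    show "S \<subseteq> difference_set E" using E'(1) e(1) unfolding S_def difference_set_def by blast
    show "colour_recurrent k S" by fact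
    show "\<bar>s\<bar> > M" if s: "s \<in> S" for s
    proof -
      obtain X Y where XY: "s = e (h X) - e (h Y)" "X \<subseteq> I" "Y \<subseteq> I" "d < card ((X - Y) \<union> (Y - X)) + k"
        using S_cases[OF s] by blast
      then have "X \<noteq> Y" using d(1) by auto
      then have "h X \<noteq> h Y" using g XY(2,3) by metis
      then show ?thesis unfolding XY(1) using lacunary_difference_gt[OF e0 \<open>M \<ge> 0\<close> growth] by blast
    qed
    show "avoids A' s" if "s \<in> S" for s using avoid that .
    show "avoids A' s" if "\<bar>s\<bar> \<le> M" "avoids A s" for s
      unfolding A'_def using a(2)[OF that(1)] that(2) \<open>R > 0\<close> by (intro majority_merge_avoids_small)
    show "Q * (2 * R) > 0" using A(1) \<open>R > 0\<close> by simp
    show "periodic (Q * (2 * R)) A'" unfolding A'_def by (rule periodic_majority_merge[OF A(2)])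
    show "avoids A' c'" using avoid \<open>c' \<in> S\<close> .
    define \<alpha> where "\<alpha> = card (A \<inter> {0..<Q * (2 * R)})"
    define \<beta> where "\<beta> = card (A' \<inter> {0..<Q * (2 * R)})"
    have "(1 - eps) * real \<alpha> \<le> real \<beta>"
    proof (rule density_loss)
      have "real (2 * \<alpha> * (B * nat (R - 2 * D) ^ d)) \<le> real (nat (2 * R) ^ d * \<beta>)"
        using t unfolding \<alpha>_def \<beta>_def A'_def by (simp only: of_nat_le_iff)
      then show "2 * real \<alpha> * (real B * (real_of_int R - 2 * real_of_int D) ^ d) \<le> (2 * real_of_int R) ^ d * real \<beta>"
        using \<open>R > 0\<close> D2 by simp
      have "4 * real d \<le> K * eps" using K(2) eps(1) by (simp add: pos_divide_le_eq)
      then have "4 * real d * D \<le> K * eps * D" using D(1) by (intro mult_right_mono) auto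
      also have "\<dots> = eps * real_of_int (K * D)" by simp
      also have "\<dots> \<le> eps * real_of_int R" using D(2) eps(1) by (intro mult_left_mono) (auto simp del: of_int_mult)
      finally show "4 * real d * real_of_int D \<le> eps * real_of_int R" .
      show "(1 - eps / 2) * 2 ^ d \<le> 2 * real B" using d(3) by (simp add: B_def I_def)
    qed (use \<open>R > 0\<close> D D2 eps in simp_all)
    moreover have "\<alpha> = nat (2 * R) * card (A \<inter> {0..<Q})"
      using card_periodic_multiple[OF A(1,2), of "nat (2 * R)"] \<open>R > 0\<close> by (simp add: \<alpha>_def)
    then have "\<delta> * (Q * (2 * R)) \<le> real \<alpha>"
      using mult_left_mono[OF dens(1), of "2 * R"] \<open>R > 0\<close> by (simp add: algebra_simps)
    then have "(1 - eps) * (\<delta> * (Q * (2 * R))) \<le> (1 - eps) * real \<alpha>"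
      using eps(2) by (intro mult_left_mono) auto
    ultimately show "\<delta>' * real_of_int (Q * (2 * R)) \<le> card (A' \<inter> {0..<Q * (2 * R)})"
      unfolding \<beta>_def eps(3) by (simp add: mult.assoc)
  qed
qed

section \<open>Iteration\<close>

lemma uminus_difference_set: "difference_set (uminus ` E) = difference_set E"
proof
  have "- a - - b \<in> difference_set E" if "a \<in> E" "b \<in> E" for a b
    using that unfolding difference_set_def by (intro CollectI exI[of _ b] exI[of _ a]) simp
  then show "difference_set (uminus ` E) \<subseteq> difference_set E" unfolding difference_set_def by blast
  have "a - b = - b - - a" for a b :: int by simp
  then show "difference_set E \<subseteq> difference_set (uminus ` E)" unfolding difference_set_def by blast
qed

lemma chromatically_recurrentI:
  assumes "\<And>r. \<exists>k\<ge>r. \<exists>S'\<subseteq>S. colour_recurrent k S'"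
  shows "chromatically_recurrent S"
  unfolding chromatically_recurrent_def
proof (intro allI impI)
  fix P :: "int set set" assume P: "finite P \<and> partition_on UNIV P"
  obtain g :: "int set \<Rightarrow> nat" where g: "bij_betw g P {0..<card P}" using P ex_bij_betw_finite_nat by blast
  obtain k S' where k: "card P \<le> k" "S' \<subseteq> S" "colour_recurrent k S'" using assms by blast
  have "\<forall>x. \<exists>A\<in>P. x \<in> A" using P by (auto simp: partition_on_def)
  then obtain cell where cell: "\<And>x. cell x \<in> P" "\<And>x. x \<in> cell x" by metis
  have "g (cell x) < k" for x using bij_betwE[OF g] cell(1)[of x] k(1) by fastforce
  then obtain x y where xy: "g (cell x) = g (cell y)" "x - y \<in> S'"
    using k(3) unfolding colour_recurrent_def by fastforce
  then have "cell x = cell y" using g cell(1) by (auto simp: bij_betw_def dest: inj_onD)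
  then have "x - y \<in> difference_set (cell x)" using cell(2) unfolding difference_set_def by (metis (mono_tags, lifting) mem_Collect_eq)
  then show "\<exists>A\<in>P. difference_set A \<inter> S \<noteq> {}" using cell(1) xy(2) k(2) by blast
qed

lemma upper_density_ge:
  fixes r :: "nat \<Rightarrow> nat"
  assumes "strict_mono r" "\<And>l. c * real (r l) \<le> card (A \<inter> {1..int (r l)})" "\<And>l. r l > 0"
  shows "upper_density A \<ge> ereal c"
proof -
  let ?X = "\<lambda>n. ereal (real (card (A \<inter> {1..int n})) / real n)"
  have "ereal c \<le> (?X \<circ> r) l" for l using assms(2,3)[of l] by (simp add: pos_le_divide_eq)
  then have "ereal c \<le> liminf (?X \<circ> r)" by (intro Liminf_bounded always_eventually) simp
  also have "\<dots> \<le> limsup (?X \<circ> r)" by (rule Liminf_le_Limsup) simp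
  also have "\<dots> \<le> limsup ?X" by (rule limsup_subseq_mono[OF assms(1)])
  finally show ?thesis by (simp add: upper_density_def)
qed

text \<open>Of the share \<open>1 / 4\<close> one half survives the loss of \<open>{0..L}\<close>,
  because the choice of \<open>m\<close> forces \<open>L + 1 \<le> M / 8\<close>.\<close>

lemma dense_block:
  assumes "Q > 0" "periodic Q A" "Q / 4 \<le> real (card (A \<inter> {0..<Q}))" "L \<ge> 0"
  obtains M where "M > L" "M > N" "real_of_int M / 8 \<le> card (A \<inter> {L<..M})"
proof -
  define m where "m = nat (8 * (L + 1) + \<bar>N\<bar> + 1)"
  define M where "M = Q * int m"
  have m: "int m = 8 * (L + 1) + \<bar>N\<bar> + 1" using assms(4) by (simp add: m_def)
  have "1 * int m \<le> Q * int m" using assms(1) by (intro mult_right_mono) auto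
  then have M: "M \<ge> 8 * (L + 1) + \<bar>N\<bar> + 1" using m by (simp add: M_def)
  have "real_of_int M / 4 \<le> card (A \<inter> {0..<M})"
    using card_periodic_multiple[OF assms(1,2), of m] mult_left_mono[OF assms(3), of "real m"]
    by (simp add: M_def mult.commute)
  also have "A \<inter> {0..<M} \<subseteq> (A \<inter> {L<..M}) \<union> {0..L}" by auto
  then have "card (A \<inter> {0..<M}) \<le> card ((A \<inter> {L<..M}) \<union> {0..L})" by (intro card_mono) auto
  also have "\<dots> \<le> card (A \<inter> {L<..M}) + card {0..L}" by (rule card_Un_le)
  also have "real (card (A \<inter> {L<..M}) + card {0..L}) = card (A \<inter> {L<..M}) + (L + 1)" using assms(4) by simp
  finally have "real_of_int M / 4 \<le> card (A \<inter> {L<..M}) + (L + 1)" by simp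
  moreover have "real_of_int (8 * (L + 1)) \<le> M" using M by (simp only: of_int_le_iff)
  ultimately have "real_of_int M / 8 \<le> card (A \<inter> {L<..M})" by simp
  then show ?thesis using that[of M] M assms(4) by auto
qed

text \<open>Only the part of \<open>A n\<close> in \<open>{L n<..M n}\<close> is used later.
  Differences of stage \<open>Suc n\<close> are too long for the first \<open>n\<close> blocks, and
  the gap from \<open>M n\<close> to \<open>L (Suc n)\<close> is at least as long as every
  difference of stage up to \<open>Suc n\<close>.\<close>

lemma recurrence_sequence:
  assumes "infinite (E \<inter> {0..})"
  obtains S A :: "nat \<Rightarrow> int set" and L M :: "nat \<Rightarrow> int" where
    "\<And>n. S n \<subseteq> difference_set E" "\<And>n. colour_recurrent (Suc n) (S (Suc n))"
    "\<And>n s. s \<in> S (Suc n) \<Longrightarrow> \<bar>s\<bar> > M n"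
    "\<And>i n s. i \<le> n \<Longrightarrow> s \<in> S i \<Longrightarrow> avoids (A n) s"
    "\<And>i n s. i \<le> Suc n \<Longrightarrow> s \<in> S i \<Longrightarrow> M n + \<bar>s\<bar> \<le> L (Suc n)"
    "\<And>n. L n \<ge> 0" "\<And>n. L n < M n" "\<And>n. M n \<le> L (Suc n)"
    "\<And>n. real_of_int (M n) / 8 \<le> card (A n \<inter> {L n<..M n})"
proof -
  \<comment> \<open>Strictly decreasing from \<open>1 / 2\<close>, the density of the even numbers,
    towards \<open>1 / 4\<close>, which leaves every stage some density to lose.\<close>
  define \<delta> :: "nat \<Rightarrow> real" where "\<delta> n = 1 / 4 + 1 / (4 * 2 ^ n)" for n
  have \<delta>: "\<delta> (Suc n) < \<delta> n" "0 < \<delta> (Suc n)" "\<delta> n \<ge> 1 / 4" for n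
    by (simp_all add: \<delta>_def field_simps add_pos_pos)
  define P :: "nat \<Rightarrow> int set \<times> int set \<times> int \<times> int \<Rightarrow> bool" where "P = (\<lambda>n (S, A, L, M). S \<subseteq> difference_set E \<and> 0 \<le> L \<and> L < M \<and>
    (\<forall>s\<in>S. \<bar>s\<bar> \<le> M \<and> avoids A s) \<and> real_of_int M / 8 \<le> card (A \<inter> {L<..M}) \<and>
    (\<exists>Q c. Q > 0 \<and> periodic Q A \<and> avoids A c \<and> \<delta> n * Q \<le> card (A \<inter> {0..<Q})))"
  define R :: "nat \<Rightarrow> int set \<times> int set \<times> int \<times> int \<Rightarrow> int set \<times> int set \<times> int \<times> int \<Rightarrow> bool" where "R = (\<lambda>n (S, A, L, M) (S', A', L', M'). colour_recurrent (Suc n) S' \<and>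
    (\<forall>s\<in>S'. \<bar>s\<bar> > M) \<and> (\<forall>s. \<bar>s\<bar> \<le> M \<longrightarrow> avoids A s \<longrightarrow> avoids A' s) \<and>
    (\<forall>s\<in>S'. M + \<bar>s\<bar> \<le> L') \<and> M + M \<le> L')"
  have "\<exists>f :: nat \<Rightarrow> int set \<times> int set \<times> int \<times> int. \<forall>n. P n (f n) \<and> R n (f n) (f (Suc n))"
  proof (rule dependent_nat_choice)
    \<comment> \<open>The even numbers have the disjoint translate by 1. Stage 0 contributes no
      differences.\<close>
    define A where "A = {n :: int. even n}"
    have A: "periodic 2 A" "avoids A 1" by (simp_all add: A_def periodic_def avoids_def)
    have "A \<inter> {0..<2} = {0}" unfolding A_def by (auto simp: less_le)
    then have c: "card (A \<inter> {0..<2}) = 1" by simp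
    obtain M where M: "M > 0" "real_of_int M / 8 \<le> card (A \<inter> {0<..M})"
      using dense_block[of 2 A 0 0] A c by auto
    have "\<exists>Q c. Q > 0 \<and> periodic Q A \<and> avoids A c \<and> \<delta> 0 * Q \<le> card (A \<inter> {0..<Q})"
      using A c by (intro exI[of _ 2] exI[of _ 1]) (simp add: \<delta>_def)
    then have "P 0 ({}, A, 0, M)" using M by (simp add: P_def)
    then show "\<exists>x. P 0 x" by blast
  next
    fix x n assume Px: "P n x"
    obtain S A L M where x: "x = (S, A, L, M)" by (cases x)
    from Px obtain Q c where st: "S \<subseteq> difference_set E" "0 \<le> L" "L < M" "\<forall>s\<in>S. \<bar>s\<bar> \<le> M \<and> avoids A s"
      and Q: "Q > 0" "periodic Q A" "avoids A c" "\<delta> n * Q \<le> card (A \<inter> {0..<Q})"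
      unfolding P_def x by auto
    have "M \<ge> 0" using st by simp
    obtain S' A' Q' c' where S': "finite S'" "S' \<subseteq> difference_set E" "colour_recurrent (Suc n) S'"
      "\<And>s. s \<in> S' \<Longrightarrow> \<bar>s\<bar> > M" "\<And>s. s \<in> S' \<Longrightarrow> avoids A' s"
      "\<And>s. \<bar>s\<bar> \<le> M \<Longrightarrow> avoids A s \<Longrightarrow> avoids A' s"
      and Q': "Q' > 0" "periodic Q' A'" "avoids A' c'" "\<delta> (Suc n) * Q' \<le> card (A' \<inter> {0..<Q'})"
      by (rule recurrence_step[OF assms Q \<delta>(2) \<delta>(1) \<open>M \<ge> 0\<close>, of "Suc n"]) (simp, blast)
    define b where "b = Max (abs ` S')"
    have b: "\<bar>s\<bar> \<le> b" if "s \<in> S'" for s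
      unfolding b_def using S'(1) that by (intro Max_ge) auto
    \<comment> \<open>The gap must exceed old and new differences: the old ones are at most
      \<open>M\<close>, the new ones at most \<open>b\<close>.\<close>
    define L' where "L' = M + max M \<bar>b\<bar>"
    have L': "L' \<ge> 0" "M + M \<le> L'" using st by (simp_all add: L'_def)
    have bL: "M + \<bar>s\<bar> \<le> L'" if "s \<in> S'" for s using b[OF that] by (simp add: L'_def)
    have "Q' / 4 \<le> card (A' \<inter> {0..<Q'})"
    proof -
      have "1 / 4 * real_of_int Q' \<le> \<delta> (Suc n) * Q'" using Q'(1) \<delta>(3) by (intro mult_right_mono) auto
      then show ?thesis using Q'(4) by simp
    qed
    then obtain M' where M': "M' > L'" "real_of_int M' / 8 \<le> card (A' \<inter> {L'<..M'})"
      using dense_block[OF Q'(1,2) _ L'(1)] by blast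
    have "\<bar>s\<bar> \<le> M'" if "s \<in> S'" for s using bL[OF that] M'(1) \<open>M \<ge> 0\<close> by simp
    moreover have "\<exists>Q c. Q > 0 \<and> periodic Q A' \<and> avoids A' c \<and> \<delta> (Suc n) * Q \<le> card (A' \<inter> {0..<Q})"
      using Q' by blast
    ultimately have "P (Suc n) (S', A', L', M')"
      unfolding P_def using S'(2,5) L'(1) M' by simp
    moreover have "R n x (S', A', L', M')"
      unfolding R_def x using S'(3,4,6) bL L' by simp
    ultimately show "\<exists>y. P (Suc n) y \<and> R n x y" by blast
  qed
  then obtain f :: "nat \<Rightarrow> int set \<times> int set \<times> int \<times> int"
    where f: "\<And>n. P n (f n)" "\<And>n. R n (f n) (f (Suc n))" by blast
  define S where "S n = fst (f n)" for n
  define A where "A n = fst (snd (f n))" for n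
  define L where "L n = fst (snd (snd (f n)))" for n
  define M where "M n = snd (snd (snd (f n)))" for n
  have f_eq: "f n = (S n, A n, L n, M n)" for n by (simp add: S_def A_def L_def M_def)
  have P: "S n \<subseteq> difference_set E" "0 \<le> L n" "L n < M n" "\<And>s. s \<in> S n \<Longrightarrow> \<bar>s\<bar> \<le> M n"
    "\<And>s. s \<in> S n \<Longrightarrow> avoids (A n) s" "real_of_int (M n) / 8 \<le> card (A n \<inter> {L n<..M n})" for n
    using f(1)[of n] unfolding P_def f_eq by auto
  have R: "colour_recurrent (Suc n) (S (Suc n))" "\<And>s. s \<in> S (Suc n) \<Longrightarrow> \<bar>s\<bar> > M n"
    "\<And>s. \<bar>s\<bar> \<le> M n \<Longrightarrow> avoids (A n) s \<Longrightarrow> avoids (A (Suc n)) s"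
    "\<And>s. s \<in> S (Suc n) \<Longrightarrow> M n + \<bar>s\<bar> \<le> L (Suc n)" "M n + M n \<le> L (Suc n)" for n
    using f(2)[of n] unfolding R_def f_eq by auto
  have M_le_L: "M n \<le> L (Suc n)" for n using R(5)[of n] P(2,3)[of n] by simp
  have inherited: "\<bar>s\<bar> \<le> M n \<and> avoids (A n) s" if "i \<le> n" "s \<in> S i" for i n s
    using that(1)
  proof (induction rule: dec_induct)
    case base then show ?case using P(4,5) that(2) by simp
  next
    case (step n)
    then have "avoids (A (Suc n)) s" using R(3) by blast
    then show ?case using step.IH M_le_L[of n] P(3)[of "Suc n"] by simp
  qed
  show ?thesis
  proof (rule that[of S M A L])
    show "avoids (A n) s" if "i \<le> n" "s \<in> S i" for i n s using inherited[OF that] by simp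
    show "M n + \<bar>s\<bar> \<le> L (Suc n)" if "i \<le> Suc n" "s \<in> S i" for i n s
    proof (cases "i \<le> n")
      case True
      then show ?thesis using inherited[OF True that(2)] R(5)[of n] by simp
    next
      case False
      then have "i = Suc n" using that(1) by simp
      then show ?thesis using R(4) that(2) by blast
    qed
  qed (use P R M_le_L in blast)+
qed

theorem theorem1p2:
  fixes E :: "int set"
  assumes "infinite E"
  shows "\<exists>S. S \<subseteq> difference_set E \<and> chromatically_recurrent S \<and> \<not> density_recurrent S"
proof -
  \<comment> \<open>If \<open>E\<close> has only finitely many nonnegative elements, its reflection
    has infinitely many and the same differences.\<close>
  obtain E' where E': "infinite (E' \<inter> {0..})" "difference_set E' = difference_set E"
  proof (cases "finite (E \<inter> {0..})")
    case True
    have "E = (E \<inter> {0..}) \<union> (E \<inter> {..<0})" by auto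
    then have "infinite (E \<inter> {..<0})" using assms True by (metis finite_Un)
    then have "infinite (uminus ` (E \<inter> {..<0}))" by (simp add: finite_image_iff)
    moreover have "uminus ` (E \<inter> {..<0}) \<subseteq> uminus ` E \<inter> {0..}" by auto
    ultimately have "infinite (uminus ` E \<inter> {0..})" using finite_subset by blast
    then show ?thesis using that[of "uminus ` E"] uminus_difference_set by blast
  next
    case False
    then show ?thesis using that[of E] by blast
  qed
  obtain S A :: "nat \<Rightarrow> int set" and L M :: "nat \<Rightarrow> int" where S: "\<And>n. S n \<subseteq> difference_set E'"
    "\<And>n. colour_recurrent (Suc n) (S (Suc n))"
    and new: "\<And>n s. s \<in> S (Suc n) \<Longrightarrow> \<bar>s\<bar> > M n"
    and avoid: "\<And>i n s. i \<le> n \<Longrightarrow> s \<in> S i \<Longrightarrow> avoids (A n) s"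
    and gap: "\<And>i n s. i \<le> Suc n \<Longrightarrow> s \<in> S i \<Longrightarrow> M n + \<bar>s\<bar> \<le> L (Suc n)"
    and LM: "\<And>n. L n \<ge> 0" "\<And>n. L n < M n" "\<And>n. M n \<le> L (Suc n)"
    and dense: "\<And>n. real_of_int (M n) / 8 \<le> card (A n \<inter> {L n<..M n})"
    by (rule recurrence_sequence[OF E'(1)]) blast
  have MSuc: "M n < M (Suc n)" for n using LM(2)[of "Suc n"] LM(3)[of n] by simp
  have mono: "M m \<le> M n" if "m \<le> n" for m n
    using less_imp_le[OF MSuc] that by (rule lift_Suc_mono_le)
  define S' where "S' = (\<Union>n. S (Suc n))"
  define block where "block n = A n \<inter> {L n<..M n}" for n
  define A' where "A' = (\<Union>n. block (Suc n))"
  \<comment> \<open>A difference of stage at most \<open>p\<close> cannot bridge the gap before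
    block \<open>p\<close>; one of a later stage exceeds \<open>M p\<close>, hence any distance
    between positive numbers up to \<open>M p\<close>.\<close>
  have far: "\<bar>u - v\<bar> \<noteq> \<bar>s\<bar>" if uv: "u \<in> block p" "v \<in> block q" "q < p" and s: "s \<in> S (Suc j)" for u v p q s j
  proof (cases "Suc j \<le> p")
    case True
    obtain n where n: "p = Suc n" using uv(3) by (cases p) auto
    have "v \<le> M n" using uv(2,3) mono[of q n] n by (simp add: block_def)
    moreover have "u > M n + \<bar>s\<bar>" using uv(1) gap[OF _ s, of n] True n by (simp add: block_def)
    ultimately show ?thesis by simp
  next
    case False
    then have "\<bar>s\<bar> > M p" using new[OF s] mono[of p j] by simp
    moreover have "u \<le> M p" "v \<le> M p" "u > 0" "v > 0"
      using uv mono[of q p] LM(1)[of p] LM(1)[of q] by (simp_all add: block_def)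
    ultimately show ?thesis by simp
  qed
  have A': "avoids A' s" if "s \<in> S'" for s
    unfolding avoids_def
  proof (intro ballI notI)
    fix x assume "x \<in> A'" "x - s \<in> A'"
    then obtain p q where pq: "x \<in> block p" "x - s \<in> block q" unfolding A'_def by blast
    obtain j where j: "s \<in> S (Suc j)" using \<open>s \<in> S'\<close> unfolding S'_def by blast
    consider "p < q" | "q < p" | "p = q" by linarith
    then show False
    proof cases
      case 1 then show False using far[OF pq(2,1) 1 j] by simp
    next
      case 2 then show False using far[OF pq 2 j] by simp
    next
      \<comment> \<open>Within one block, differences of stage at most \<open>p\<close> are excluded
        by \<open>A p\<close>, and later ones are longer than the block.\<close>
      case 3
      show False
      proof (cases "Suc j \<le> p")
        case True
        then show False using avoid[OF True j] pq 3 by (auto simp: avoids_def block_def)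
      next
        case False
        then have "\<bar>s\<bar> > M p" using new[OF j] mono[of p j] by simp
        then show False using pq 3 LM(1)[of p] by (auto simp: block_def)
      qed
    qed
  qed
  have "ereal (1 / 8) \<le> upper_density A'"
  proof (rule upper_density_ge[where r = "\<lambda>n. nat (M (Suc n))"])
    have pos: "M n > 0" for n using LM(1,2)[of n] by simp
    show "strict_mono (\<lambda>n. nat (M (Suc n)))"
      using MSuc pos by (intro strict_mono_Suc_iff[THEN iffD2]) simp
    show "nat (M (Suc n)) > 0" for n using pos by simp
    fix n
    have "block (Suc n) \<subseteq> A' \<inter> {1..M (Suc n)}"
      using LM(1)[of "Suc n"] by (auto simp: A'_def block_def)
    then have "card (block (Suc n)) \<le> card (A' \<inter> {1..M (Suc n)})" by (intro card_mono) auto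
    then show "1 / 8 * real (nat (M (Suc n))) \<le> real (card (A' \<inter> {1..int (nat (M (Suc n)))}))"
      using dense[of "Suc n"] pos[of "Suc n"] by (simp add: block_def)
  qed
  then have "upper_density A' > 0" by (rule less_le_trans[rotated]) simp
  moreover have "difference_set A' \<inter> S' = {}"
    using A' unfolding difference_set_def avoids_def by force
  ultimately have "\<not> density_recurrent S'" by (auto simp: density_recurrent_def)
  moreover have "chromatically_recurrent S'"
  proof (rule chromatically_recurrentI)
    fix r show "\<exists>k\<ge>r. \<exists>T\<subseteq>S'. colour_recurrent k T"
      using S(2)[of r] by (intro exI[of _ "Suc r"] conjI exI[of _ "S (Suc r)"]) (auto simp: S'_def)
  qed
  moreover have "S' \<subseteq> difference_set E" using S(1) E'(2) unfolding S'_def by blast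
  ultimately show ?thesis by blast
qed

end
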